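(* Let $\Phi$ be a simply-laced irreducible crystallographic root system of rank $n$ with Coxeter number $h$, and let $b$ be a positive integer with $\gcd(h,b)=1$. Then \[\max_{\lambda \in \mathcal{S}_\Phi(b)\cap \check{Q}}{\sf size}(\lambda) = \frac{n(b^2-1)(h+1)}{24},\] and this maximum is attained at a unique point $\lambda\in \mathcal{S}_\Phi(b)\cap\check{Q}$.
   Context: $\Phi$ lives in a Euclidean space $V$ with inner product $\langle\cdot,\cdot\rangle$ normalized so that the highest root $\tilde\alpha$ satisfies $\|\tilde\alpha\|^2=2$; simply-laced means every root has $\|\alpha\|^2=2$. Fix positive roots $\Phi^+$ with simple roots $\alpha_1,\dots,\alpha_n$; the height of $\alpha=\sum a_i\alpha_i$ is $\mathrm{ht}(\alpha)=\sum a_i$, $\Phi_l$ denotes the set of roots of height $l$, and $h=1+\mathrm{ht}(\tilde\alpha)$. The coroot lattice $\check Q$ is the lattice generated by the coroots $2\alpha/\|\alpha\|^2$ (in the simply-laced case, the root lattice). Let $\rho=\frac12\sum_{\alpha\in\Phi^+}\alpha$, and let $g$ be the dual Coxeter number ($g=h$ in the simply-laced case). For $x\in V$, ${\sf size}(x):=\frac{g}{2}\|x\|^2-\langle x,\rho\rangle$. Writing $b=th+r$ with integers $t\ge 0$ and $0<r<h$, the Sommers region is $\mathcal{S}_\Phi(b):=\{x\in V:\langle x,\alpha\rangle\geq-t \text{ for all }\alpha\in\Phi_r,\ \langle x,\alpha\rangle\leq t+1\text{ for all }\alpha\in\Phi_{h-r}\}$. *)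

theory Defs
  imports "HOL-Analysis.Analysis" "HOL-Computational_Algebra.Group_Closure"
begin

definition coroot :: "'a::euclidean_space \<Rightarrow> 'a" where
  "coroot \<alpha> = (2 / (norm \<alpha>)\<^sup>2) *\<^sub>R \<alpha>"

definition root_reflection :: "'a::euclidean_space \<Rightarrow> 'a \<Rightarrow> 'a" where
  "root_reflection \<alpha> x = x - (x \<bullet> coroot \<alpha>) *\<^sub>R \<alpha>"

(* Root systems are reduced, and they span the ambient Euclidean space. *)
definition crystallographic_root_system :: "'a::euclidean_space set \<Rightarrow> bool" where
  "crystallographic_root_system \<Phi> \<longleftrightarrow>
     finite \<Phi> \<and> 0 \<notin> \<Phi> \<and> span \<Phi> = UNIV \<and>
     (\<forall>\<alpha>\<in>\<Phi>. root_reflection \<alpha> ` \<Phi> = \<Phi>) \<and>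
     (\<forall>\<alpha>\<in>\<Phi>. \<forall>c. c *\<^sub>R \<alpha> \<in> \<Phi> \<longrightarrow> c = 1 \<or> c = -1) \<and>
     (\<forall>\<alpha>\<in>\<Phi>. \<forall>\<beta>\<in>\<Phi>. \<beta> \<bullet> coroot \<alpha> \<in> \<int>)"

definition irreducible_root_system :: "'a::euclidean_space set \<Rightarrow> bool" where
  "irreducible_root_system \<Phi> \<longleftrightarrow>
     \<Phi> \<noteq> {} \<and>
     \<not> (\<exists>A B. A \<noteq> {} \<and> B \<noteq> {} \<and> A \<union> B = \<Phi> \<and> A \<inter> B = {} \<and>
             (\<forall>\<alpha>\<in>A. \<forall>\<beta>\<in>B. \<alpha> \<bullet> \<beta> = 0))"

(* This includes the normalization that the highest root has squared length 2. *)
definition simply_laced :: "'a::euclidean_space set \<Rightarrow> bool" where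
  "simply_laced \<Phi> \<longleftrightarrow> (\<forall>\<alpha>\<in>\<Phi>. (norm \<alpha>)\<^sup>2 = 2)"

(* \<Delta> is the set of simple roots of some choice of positive roots, that is, a base of \<Phi>.
   The real number "representation \<Delta> \<alpha> \<delta>" is the coefficient of \<delta> in the
   expansion of \<alpha> in the basis \<Delta>. *)
definition simple_roots :: "'a::euclidean_space set \<Rightarrow> 'a set \<Rightarrow> bool" where
  "simple_roots \<Phi> \<Delta> \<longleftrightarrow>
     \<Delta> \<subseteq> \<Phi> \<and> independent \<Delta> \<and> span \<Delta> = UNIV \<and>
     (\<forall>\<alpha>\<in>\<Phi>. (\<forall>\<delta>\<in>\<Delta>. representation \<Delta> \<alpha> \<delta> \<in> \<int>) \<and>
        ((\<forall>\<delta>\<in>\<Delta>. 0 \<le> representation \<Delta> \<alpha> \<delta>) \<or>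
         (\<forall>\<delta>\<in>\<Delta>. representation \<Delta> \<alpha> \<delta> \<le> 0)))"

definition positive_roots :: "'a::euclidean_space set \<Rightarrow> 'a set \<Rightarrow> 'a set" where
  "positive_roots \<Phi> \<Delta> = {\<alpha>\<in>\<Phi>. \<forall>\<delta>\<in>\<Delta>. 0 \<le> representation \<Delta> \<alpha> \<delta>}"

definition height :: "'a::euclidean_space set \<Rightarrow> 'a \<Rightarrow> real" where
  "height \<Delta> \<alpha> = (\<Sum>\<delta>\<in>\<Delta>. representation \<Delta> \<alpha> \<delta>)"

definition roots_of_height :: "'a::euclidean_space set \<Rightarrow> 'a set \<Rightarrow> nat \<Rightarrow> 'a set" where
  "roots_of_height \<Phi> \<Delta> l = {\<alpha>\<in>\<Phi>. height \<Delta> \<alpha> = real l}"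

(* The root whose coefficients dominate those of every other root; it exists and is unique
   when \<Phi> is irreducible. *)
definition highest_root :: "'a::euclidean_space set \<Rightarrow> 'a set \<Rightarrow> 'a" where
  "highest_root \<Phi> \<Delta> =
     (THE \<theta>. \<theta> \<in> \<Phi> \<and>
        (\<forall>\<beta>\<in>\<Phi>. \<forall>\<delta>\<in>\<Delta>. representation \<Delta> \<beta> \<delta> \<le> representation \<Delta> \<theta> \<delta>))"

(* Heights of roots are integers, so the floor only changes the type. *)
definition coxeter_number :: "'a::euclidean_space set \<Rightarrow> 'a set \<Rightarrow> nat" where
  "coxeter_number \<Phi> \<Delta> = nat \<lfloor>1 + height \<Delta> (highest_root \<Phi> \<Delta>)\<rfloor>"

(* One plus the height of the coroot of the highest root, measured in the simple coroots. *)
definition dual_coxeter_number :: "'a::euclidean_space set \<Rightarrow> 'a set \<Rightarrow> real" where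
  "dual_coxeter_number \<Phi> \<Delta> = 1 + height (coroot ` \<Delta>) (coroot (highest_root \<Phi> \<Delta>))"

definition coroot_lattice :: "'a::euclidean_space set \<Rightarrow> 'a set" where
  "coroot_lattice \<Phi> = group_closure (coroot ` \<Phi>)"

definition weyl_vector :: "'a::euclidean_space set \<Rightarrow> 'a set \<Rightarrow> 'a" where
  "weyl_vector \<Phi> \<Delta> = (1/2) *\<^sub>R (\<Sum>\<alpha>\<in>positive_roots \<Phi> \<Delta>. \<alpha>)"

definition size_stat :: "'a::euclidean_space set \<Rightarrow> 'a set \<Rightarrow> 'a \<Rightarrow> real" where
  "size_stat \<Phi> \<Delta> x =
     dual_coxeter_number \<Phi> \<Delta> / 2 * (norm x)\<^sup>2 - x \<bullet> weyl_vector \<Phi> \<Delta>"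

(* Meant for b not divisible by the Coxeter number h, so that b = t h + r with 0 < r < h. *)
definition sommers_region :: "'a::euclidean_space set \<Rightarrow> 'a set \<Rightarrow> nat \<Rightarrow> 'a set" where
  "sommers_region \<Phi> \<Delta> b =
     (let h = coxeter_number \<Phi> \<Delta>; t = b div h; r = b mod h in
      {x. (\<forall>\<alpha>\<in>roots_of_height \<Phi> \<Delta> r. x \<bullet> \<alpha> \<ge> - real t) \<and>
          (\<forall>\<alpha>\<in>roots_of_height \<Phi> \<Delta> (h - r). x \<bullet> \<alpha> \<le> real t + 1)})"

end

(* Writing size x = h/2 |x - rho/h|^2 - |rho|^2/(2h), one has to find the point of the Sommers
   region farthest from rho/h. An affine map w x + q, with w an automorphism of the root system
   and q in the lattice, sends b rho/h to rho/h and the b-fold dilation of the fundamental alcove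
   to the Sommers region, so the farthest points from b rho/h in the dilated alcove are wanted.
   For y there, h |y|^2 = sum <y, beta>^2 <= b sum <y, beta> = 2 b <y, rho> (sums over positive
   roots), that is |y - b rho/h| <= |b rho/h|. Equality makes y/b minuscule; since h y/b and y lie in
   the lattice and h, b are coprime, y/b lies in the lattice, which forces y = 0. The value
   |rho|^2 = n h (h + 1) / 12 (the strange formula) comes from counting pairs of positive roots
   with inner product 1 and -1. *)

theory Submission
  imports Defs
begin

text \<open>The Sommers region is cut out by heights, the dilated alcove by the simple roots and
  \<open>\<theta>\<close>. A congruence links them: pairing w(b rho/h) + q = rho/h with a root w
  beta gives ht(w beta) = b ht(beta) + h <q, w beta>. Simple roots have height 1 and -theta has
  height 1 - h, so their images have height congruent to b modulo h. Root heights lie strictly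
  between -h and h, which leaves only r and r - h, and up to sign these are the heights r and h - r
  that define the region. Coprimality enters three times: b rho/h lies on no affine wall, hence
  inside an alcove; the congruence can be inverted, which puts q in the region; and y/b lies in the
  lattice. The maximum is attained at q, the image of y = 0. The identity sum <y, beta>^2 = h |y|^2
  holds because the operator sum <x, beta> beta is scalar by irreducibility; the scalar is read off
  at \<open>\<theta>\<close>, whose products with the other positive roots are 0 or 1.\<close>

locale simply_laced_root_system =
  fixes \<Phi> \<Delta> :: "'a::euclidean_space set"
  assumes crystallographic: "crystallographic_root_system \<Phi>"
    and irreducible: "irreducible_root_system \<Phi>"
    and laced: "simply_laced \<Phi>"
    and base: "simple_roots \<Phi> \<Delta>"
begin

abbreviation P where "P \<equiv> positive_roots \<Phi> \<Delta>"
abbreviation \<rho> where "\<rho> \<equiv> weyl_vector \<Phi> \<Delta>"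
abbreviation ht where "ht \<equiv> height \<Delta>"
abbreviation cf where "cf \<equiv> representation \<Delta>"

subsection \<open>Roots and coefficients\<close>

lemma finite_roots: "finite \<Phi>" and zero_not_root: "0 \<notin> \<Phi>" and span_roots: "span \<Phi> = UNIV"
  using crystallographic unfolding crystallographic_root_system_def by auto

section \<open>Inner products of roots of squared length 2\<close>

lemma inner_root_self: "\<alpha> \<in> \<Phi> \<Longrightarrow> \<alpha> \<bullet> \<alpha> = 2"
  using laced unfolding simply_laced_def by (simp add: power2_norm_eq_inner)

lemma coroot_eq: "\<alpha> \<in> \<Phi> \<Longrightarrow> coroot \<alpha> = \<alpha>"
  using laced unfolding simply_laced_def coroot_def by simp

lemma reflection_eq: "\<alpha> \<in> \<Phi> \<Longrightarrow> root_reflection \<alpha> x = x - (x \<bullet> \<alpha>) *\<^sub>R \<alpha>"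
  by (simp add: root_reflection_def coroot_eq)

lemma reflection_root:
  assumes "\<alpha> \<in> \<Phi>" "\<beta> \<in> \<Phi>" shows "\<beta> - (\<beta> \<bullet> \<alpha>) *\<^sub>R \<alpha> \<in> \<Phi>"
proof -
  have "root_reflection \<alpha> ` \<Phi> = \<Phi>"
    using crystallographic assms(1) unfolding crystallographic_root_system_def by blast
  then show ?thesis using assms reflection_eq by (metis imageI)
qed

lemma root_uminus: "\<alpha> \<in> \<Phi> \<Longrightarrow> - \<alpha> \<in> \<Phi>"
  using reflection_root[of \<alpha> \<alpha>] inner_root_self[of \<alpha>]
  by (simp add: scaleR_2)

lemma inner_roots_Ints: "\<alpha> \<in> \<Phi> \<Longrightarrow> \<beta> \<in> \<Phi> \<Longrightarrow> \<alpha> \<bullet> \<beta> \<in> \<int>"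
  using crystallographic coroot_eq unfolding crystallographic_root_system_def by metis

lemma inner_roots_less_2:
  assumes "\<alpha> \<in> \<Phi>" "\<beta> \<in> \<Phi>" "\<alpha> \<noteq> \<beta>" shows "\<alpha> \<bullet> \<beta> < 2"
proof -
  have "0 < (\<alpha> - \<beta>) \<bullet> (\<alpha> - \<beta>)" using assms by simp
  also have "\<dots> = 4 - 2 * (\<alpha> \<bullet> \<beta>)"
    using inner_root_self assms by (simp add: inner_diff inner_commute)
  finally show ?thesis by simp
qed

text \<open>Integrality combined with the strict bound 2, applied to \<beta> and to -\<beta>. Equal
  root lengths reduce every later case split to these three values.\<close>

lemma inner_roots_cases:
  assumes "\<alpha> \<in> \<Phi>" "\<beta> \<in> \<Phi>" "\<alpha> \<noteq> \<beta>" "\<alpha> \<noteq> - \<beta>"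
  shows "\<alpha> \<bullet> \<beta> = -1 \<or> \<alpha> \<bullet> \<beta> = 0 \<or> \<alpha> \<bullet> \<beta> = 1"
proof -
  have "\<alpha> \<bullet> \<beta> < 2" "\<alpha> \<bullet> (- \<beta>) < 2"
    using assms inner_roots_less_2 root_uminus by blast+
  moreover obtain k where "\<alpha> \<bullet> \<beta> = of_int k"
    using inner_roots_Ints assms by (metis Ints_cases)
  ultimately have "k < 2" "k > -2" by auto
  then have "k = -1 \<or> k = 0 \<or> k = 1" by linarith
  then show ?thesis using \<open>\<alpha> \<bullet> \<beta> = of_int k\<close> by auto
qed

lemma root_diff: "\<alpha> \<in> \<Phi> \<Longrightarrow> \<beta> \<in> \<Phi> \<Longrightarrow> \<alpha> \<bullet> \<beta> = 1 \<Longrightarrow> \<alpha> - \<beta> \<in> \<Phi>"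
  using reflection_root[of \<beta> \<alpha>] by simp

lemma root_add: "\<alpha> \<in> \<Phi> \<Longrightarrow> \<beta> \<in> \<Phi> \<Longrightarrow> \<alpha> \<bullet> \<beta> = -1 \<Longrightarrow> \<alpha> + \<beta> \<in> \<Phi>"
  using reflection_root[of \<beta> \<alpha>] by simp

lemma root_diff_of_inner_pos:
  assumes "\<alpha> \<in> \<Phi>" "\<beta> \<in> \<Phi>" "\<alpha> \<bullet> \<beta> > 0" "\<alpha> \<noteq> \<beta>" shows "\<alpha> \<bullet> \<beta> = 1" "\<alpha> - \<beta> \<in> \<Phi>"
proof -
  have "\<alpha> \<noteq> - \<beta>" using assms inner_root_self[of \<beta>] by auto
  then show "\<alpha> \<bullet> \<beta> = 1" using inner_roots_cases assms by force
  then show "\<alpha> - \<beta> \<in> \<Phi>" using root_diff assms by auto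
qed

lemma roots_scale: "\<alpha> \<in> \<Phi> \<Longrightarrow> c *\<^sub>R \<alpha> \<in> \<Phi> \<Longrightarrow> c = 1 \<or> c = -1"
  using crystallographic unfolding crystallographic_root_system_def by blast

lemma reflection_bij: "\<alpha> \<in> \<Phi> \<Longrightarrow> bij_betw (root_reflection \<alpha>) \<Phi> \<Phi>"
  using crystallographic finite_roots unfolding crystallographic_root_system_def
  by (metis bij_betw_def eq_card_imp_inj_on)

lemma reflection_inner:
  "\<alpha> \<in> \<Phi> \<Longrightarrow> root_reflection \<alpha> x \<bullet> root_reflection \<alpha> y = x \<bullet> y"
  by (simp add: reflection_eq inner_diff inner_root_self inner_commute algebra_simps)

lemma linear_reflection: "linear (root_reflection \<alpha>)"
  unfolding root_reflection_def
  by (intro linearI) (simp_all add: inner_add_left algebra_simps)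

section \<open>The base, coefficients and signs of roots\<close>

lemma simple_root: "\<delta> \<in> \<Delta> \<Longrightarrow> \<delta> \<in> \<Phi>"
  and independent_base: "independent \<Delta>" and span_simple: "span \<Delta> = UNIV"
  using base unfolding simple_roots_def by auto

lemma finite_base: "finite \<Delta>"
  using independent_base by (rule finiteI_independent)

lemma cf_add: "cf (x + y) \<delta> = cf x \<delta> + cf y \<delta>"
  by (simp add: representation_add independent_base span_simple)

lemma cf_diff: "cf (x - y) \<delta> = cf x \<delta> - cf y \<delta>"
  by (simp add: representation_diff independent_base span_simple)

lemma cf_uminus: "cf (- x) \<delta> = - cf x \<delta>"
  by (simp add: representation_neg independent_base span_simple)

lemma cf_scale: "cf (c *\<^sub>R x) \<delta> = c * cf x \<delta>"
  by (simp add: representation_scale independent_base span_simple)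

lemma cf_simple: "\<delta> \<in> \<Delta> \<Longrightarrow> cf \<delta> \<epsilon> = (if \<epsilon> = \<delta> then 1 else 0)"
  by (simp add: representation_basis independent_base)

lemma sum_cf: "(\<Sum>\<delta>\<in>\<Delta>. cf x \<delta> *\<^sub>R \<delta>) = x"
  by (rule real_vector.sum_representation_eq) (auto simp: independent_base span_simple finite_base)

lemma inner_cf: "x \<bullet> y = (\<Sum>\<delta>\<in>\<Delta>. cf x \<delta> * (\<delta> \<bullet> y))"
  by (subst sum_cf[of x, symmetric]) (simp add: inner_sum_left)

lemma cf_eqI: "(\<And>\<delta>. \<delta> \<in> \<Delta> \<Longrightarrow> cf x \<delta> = cf y \<delta>) \<Longrightarrow> x = y"
  using sum_cf[of x] sum_cf[of y] by (metis (no_types, lifting) sum.cong)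

lemma eq_of_inner_simple:
  assumes "\<And>\<delta>. \<delta> \<in> \<Delta> \<Longrightarrow> \<delta> \<bullet> x = \<delta> \<bullet> y" shows "x = y"
proof -
  have "(x - y) \<bullet> (x - y) = 0"
    by (subst inner_cf) (simp add: assms inner_diff_right)
  then show ?thesis by simp
qed

lemma cf_Ints: "\<alpha> \<in> \<Phi> \<Longrightarrow> \<delta> \<in> \<Delta> \<Longrightarrow> cf \<alpha> \<delta> \<in> \<int>"
  using base unfolding simple_roots_def by auto

lemma positive_root: "\<alpha> \<in> P \<Longrightarrow> \<alpha> \<in> \<Phi>"
  and cf_nonneg: "\<alpha> \<in> P \<Longrightarrow> \<delta> \<in> \<Delta> \<Longrightarrow> 0 \<le> cf \<alpha> \<delta>"
  by (auto simp: positive_roots_def)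

lemma finite_positive: "finite P"
  using finite_roots by (auto simp: positive_roots_def)

lemma simple_positive: "\<delta> \<in> \<Delta> \<Longrightarrow> \<delta> \<in> P"
  by (auto simp: positive_roots_def simple_root cf_simple)

lemma root_sign: "\<alpha> \<in> \<Phi> \<Longrightarrow> \<alpha> \<in> P \<or> - \<alpha> \<in> P"
  using base root_uminus[of \<alpha>] unfolding simple_roots_def positive_roots_def
  by (auto simp: cf_uminus)

lemma uminus_not_positive: "\<alpha> \<in> P \<Longrightarrow> - \<alpha> \<notin> P"
proof
  assume "\<alpha> \<in> P" "- \<alpha> \<in> P"
  then have "cf \<alpha> \<delta> = 0" if "\<delta> \<in> \<Delta>" for \<delta>
    using cf_nonneg[of \<alpha> \<delta>] cf_nonneg[of "- \<alpha>" \<delta>] that by (simp add: cf_uminus)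
  then have "\<alpha> = 0" using sum_cf[of \<alpha>] by simp
  then show False using positive_root[of \<alpha>] zero_not_root \<open>\<alpha> \<in> P\<close> by auto
qed

text \<open>All coefficients of a root share a sign, so one positive coefficient decides it.\<close>

lemma positive_of_cf:
  assumes "\<alpha> \<in> \<Phi>" "\<delta> \<in> \<Delta>" "cf \<alpha> \<delta> > 0" shows "\<alpha> \<in> P"
  using root_sign[OF assms(1)] cf_nonneg[of "- \<alpha>" \<delta>] assms by (auto simp: cf_uminus)

lemma roots_eq: "\<Phi> = P \<union> uminus ` P"
proof -
  have "\<alpha> \<in> uminus ` P" if "- \<alpha> \<in> P" for \<alpha>
    using that by (metis add.inverse_inverse imageI)
  then show ?thesis using root_sign positive_root root_uminus by fastforce
qed

lemma sum_roots: "sum f \<Phi> = sum f P + (\<Sum>\<alpha>\<in>P. f (- \<alpha>))"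
proof -
  have "sum f \<Phi> = sum f P + sum f (uminus ` P)"
    by (subst roots_eq, rule sum.union_disjoint) (use finite_positive uminus_not_positive in auto)
  then show ?thesis by (simp add: sum.reindex)
qed

lemma inner_simple_nonpos:
  assumes "\<delta> \<in> \<Delta>" "\<epsilon> \<in> \<Delta>" "\<delta> \<noteq> \<epsilon>" shows "\<delta> \<bullet> \<epsilon> \<le> 0"
proof (rule ccontr)
  assume "\<not> \<delta> \<bullet> \<epsilon> \<le> 0"
  then have "\<delta> - \<epsilon> \<in> \<Phi>" using root_diff_of_inner_pos simple_root assms by auto
  moreover have "cf (\<delta> - \<epsilon>) \<delta> > 0" "cf (\<delta> - \<epsilon>) \<epsilon> < 0"
    using assms by (auto simp: cf_diff cf_simple)
  ultimately show False using positive_of_cf cf_nonneg assms by (metis not_le)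
qed

text \<open>Reducedness: a positive root supported on \<delta> alone would be a multiple of
  \<delta>, hence \<delta> itself.\<close>

lemma other_cf_pos:
  assumes "\<alpha> \<in> P" "\<delta> \<in> \<Delta>" "\<alpha> \<noteq> \<delta>" shows "\<exists>\<epsilon>\<in>\<Delta>. \<epsilon> \<noteq> \<delta> \<and> cf \<alpha> \<epsilon> > 0"
proof (rule ccontr)
  assume *: "\<not> ?thesis"
  then have "cf \<alpha> \<epsilon> = 0" if "\<epsilon> \<in> \<Delta>" "\<epsilon> \<noteq> \<delta>" for \<epsilon>
    using cf_nonneg[OF assms(1)] that by (metis order_le_less)
  then have "\<alpha> = cf \<alpha> \<delta> *\<^sub>R \<delta>"
    by (intro cf_eqI) (auto simp: cf_scale cf_simple assms)
  then have "cf \<alpha> \<delta> = 1 \<or> cf \<alpha> \<delta> = -1"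
    using roots_scale[of \<delta> "cf \<alpha> \<delta>"] simple_root assms positive_root by metis
  then show False using cf_nonneg[OF assms(1,2)] \<open>\<alpha> = _\<close> assms by auto
qed

text \<open>The reflection in \<delta> changes only the coefficient of \<delta>, so a positive
  coefficient elsewhere survives and fixes the sign.\<close>

lemma simple_reflection_positive:
  assumes "\<alpha> \<in> P" "\<delta> \<in> \<Delta>" "\<alpha> \<noteq> \<delta>" shows "root_reflection \<delta> \<alpha> \<in> P"
proof -
  obtain \<epsilon> where "\<epsilon> \<in> \<Delta>" "\<epsilon> \<noteq> \<delta>" "cf \<alpha> \<epsilon> > 0" using other_cf_pos assms by blast
  then show ?thesis
    using reflection_root[of \<delta> \<alpha>] assms simple_root positive_root
    by (intro positive_of_cf[of _ \<epsilon>]) (auto simp: reflection_eq cf_diff cf_scale cf_simple)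
qed

lemma reflection_reflection: "\<alpha> \<in> \<Phi> \<Longrightarrow> root_reflection \<alpha> (root_reflection \<alpha> x) = x"
  by (simp add: reflection_eq inner_diff_left inner_root_self algebra_simps flip: scaleR_add_left)

section \<open>The Weyl vector and heights\<close>

lemma two_rho: "2 *\<^sub>R \<rho> = \<Sum>P"
  by (simp add: weyl_vector_def)

text \<open>The reflection in \<delta> permutes the positive roots other than \<delta>, so their sum
  is orthogonal to \<delta>; only \<delta> itself contributes to 2 \<rho>.\<close>

lemma inner_simple_rho:
  assumes "\<delta> \<in> \<Delta>" shows "\<delta> \<bullet> \<rho> = 1"
proof -
  let ?s = "root_reflection \<delta>" and ?P = "P - {\<delta>}"
  have "?s \<delta> = - \<delta>" by (simp add: reflection_eq simple_root assms inner_root_self scaleR_2)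
  then have ne: "?s \<alpha> \<noteq> \<delta>" if "\<alpha> \<in> P" for \<alpha>
    using reflection_reflection[OF simple_root[OF assms], of \<alpha>] that
      uminus_not_positive[OF simple_positive[OF assms]] by metis
  have "bij_betw ?s ?P ?P"
    by (rule bij_betw_byWitness[where f'="?s"])
      (use simple_root[OF assms] reflection_reflection simple_reflection_positive assms ne in auto)
  then have "\<Sum>?P = (\<Sum>\<alpha>\<in>?P. ?s \<alpha>)" by (rule sum.reindex_bij_betw[symmetric])
  also have "\<dots> = ?s (\<Sum>?P)" by (rule linear_sum[OF linear_reflection, symmetric])
  finally have "\<Sum>?P \<bullet> \<delta> = 0"
    using simple_root[OF assms] zero_not_root by (auto simp: reflection_eq)
  moreover have "2 *\<^sub>R \<rho> = \<delta> + \<Sum>?P"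
    by (simp add: two_rho sum.remove[OF finite_positive simple_positive[OF assms]])
  ultimately have "2 * (\<delta> \<bullet> \<rho>) = \<delta> \<bullet> \<delta>"
    by (metis add.right_neutral inner_add_right inner_commute inner_scaleR_right)
  then show ?thesis using inner_root_self simple_root assms by auto
qed

lemma ht_eq: "ht x = x \<bullet> \<rho>"
  unfolding height_def by (subst inner_cf) (simp add: inner_simple_rho)

lemma ht_Ints: "\<alpha> \<in> \<Phi> \<Longrightarrow> ht \<alpha> \<in> \<int>"
  unfolding height_def by (intro Ints_sum) (simp add: cf_Ints)

lemma ht_pos:
  assumes "\<alpha> \<in> P" shows "ht \<alpha> \<ge> 1"
proof -
  have "\<exists>\<delta>\<in>\<Delta>. cf \<alpha> \<delta> \<noteq> 0"
  proof (rule ccontr)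
    assume "\<not> (\<exists>\<delta>\<in>\<Delta>. cf \<alpha> \<delta> \<noteq> 0)"
    then have "\<alpha> = 0" using sum_cf[of \<alpha>] by simp
    then show False using positive_root[OF assms] zero_not_root by simp
  qed
  then have "ht \<alpha> > 0"
    unfolding height_def using cf_nonneg[OF assms] finite_base
    by (metis (no_types, lifting) order_le_less sum_pos2)
  moreover obtain k where "ht \<alpha> = of_int k"
    using ht_Ints positive_root assms by (metis Ints_cases)
  ultimately show ?thesis by simp
qed

subsection \<open>The highest root\<close>

lemma diff_simple_positive:
  assumes "\<alpha> \<in> P" "\<delta> \<in> \<Delta>" "\<alpha> \<noteq> \<delta>" "\<alpha> \<bullet> \<delta> > 0"
  shows "\<alpha> \<bullet> \<delta> = 1" "\<alpha> - \<delta> \<in> P" "ht (\<alpha> - \<delta>) = ht \<alpha> - 1"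
proof -
  show *: "\<alpha> \<bullet> \<delta> = 1"
    using root_diff_of_inner_pos assms simple_root positive_root by blast
  show "\<alpha> - \<delta> \<in> P"
    using simple_reflection_positive[OF assms(1-3)] * simple_root assms
    by (simp add: reflection_eq)
  show "ht (\<alpha> - \<delta>) = ht \<alpha> - 1"
    using assms by (simp add: ht_eq inner_diff_left inner_simple_rho)
qed

text \<open>An orthogonal splitting of the base splits the roots, which is how irreducibility of
  \<open>\<Phi>\<close> passes to \<open>\<Delta>\<close>. The induction strips one simple root at a
  time.\<close>

lemma positive_support_split:
  assumes "S \<subseteq> \<Delta>" and orth: "\<And>\<delta> \<epsilon>. \<delta> \<in> S \<Longrightarrow> \<epsilon> \<in> \<Delta> - S \<Longrightarrow> \<delta> \<bullet> \<epsilon> = 0" and "\<alpha> \<in> P"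
  shows "(\<forall>\<delta>\<in>\<Delta> - S. cf \<alpha> \<delta> = 0) \<or> (\<forall>\<delta>\<in>S. cf \<alpha> \<delta> = 0)"
  using \<open>\<alpha> \<in> P\<close>
proof (induction "nat \<lfloor>ht \<alpha>\<rfloor>" arbitrary: \<alpha> rule: less_induct)
  case less
  \<comment> \<open>Expanding \<alpha> \<bullet> \<alpha> = 2 in the base yields a simple root with
    positive product with \<alpha>, which can be subtracted.\<close>
  have "0 < (\<Sum>\<delta>\<in>\<Delta>. cf \<alpha> \<delta> * (\<delta> \<bullet> \<alpha>))"
    using inner_cf[of \<alpha> \<alpha>] inner_root_self[OF positive_root[OF less.prems]] by simp
  then obtain \<delta> where \<delta>: "\<delta> \<in> \<Delta>" "cf \<alpha> \<delta> * (\<delta> \<bullet> \<alpha>) > 0"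
    using sum_nonpos[of \<Delta> "\<lambda>\<delta>. cf \<alpha> \<delta> * (\<delta> \<bullet> \<alpha>)"] by force
  then have pos: "\<alpha> \<bullet> \<delta> > 0"
    using cf_nonneg[OF less.prems \<delta>(1)] by (simp add: inner_commute zero_less_mult_iff)
  show ?case
  proof (cases "\<alpha> = \<delta>")
    case True
    then show ?thesis using \<delta>(1) by (auto simp: cf_simple)
  next
    case False
    note d = diff_simple_positive[OF less.prems \<delta>(1) False pos]
    have "nat \<lfloor>ht (\<alpha> - \<delta>)\<rfloor> < nat \<lfloor>ht \<alpha>\<rfloor>"
      using ht_pos[OF less.prems] d(3) by linarith
    then have IH: "(\<forall>\<epsilon>\<in>\<Delta> - S. cf (\<alpha> - \<delta>) \<epsilon> = 0) \<or> (\<forall>\<epsilon>\<in>S. cf (\<alpha> - \<delta>) \<epsilon> = 0)"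
      using less.hyps d(2) by blast
    \<comment> \<open>\<open>T\<close> will be whichever of \<open>S\<close> and
      \<open>\<Delta> - S\<close> contains \<delta>. Since (\<alpha> - \<delta>) \<bullet> \<delta>
      = 1 - 2 is nonzero, \<alpha> - \<delta> must involve the side of \<delta>, so adding \<delta>
      back does not mix the sides.\<close>
    have aux: "\<exists>\<epsilon>\<in>T. cf (\<alpha> - \<delta>) \<epsilon> \<noteq> 0"
      if "\<And>\<epsilon>. \<epsilon> \<in> \<Delta> - T \<Longrightarrow> \<delta> \<bullet> \<epsilon> = 0" for T
    proof (rule ccontr)
      assume "\<not> ?thesis"
      moreover have "\<epsilon> \<bullet> \<delta> = 0" if "\<epsilon> \<in> \<Delta> - T" for \<epsilon>
        using \<open>\<And>\<epsilon>. \<epsilon> \<in> \<Delta> - T \<Longrightarrow> \<delta> \<bullet> \<epsilon> = 0\<close>[OF that] by (simp add: inner_commute[of \<epsilon>])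
      ultimately have "cf (\<alpha> - \<delta>) \<epsilon> * (\<epsilon> \<bullet> \<delta>) = 0" if "\<epsilon> \<in> \<Delta>" for \<epsilon>
        using that by (cases "\<epsilon> \<in> T") auto
      then have "(\<alpha> - \<delta>) \<bullet> \<delta> = 0" by (subst inner_cf) (rule sum.neutral, blast)
      then show False
        using d(1) inner_root_self simple_root \<delta>(1) by (simp add: inner_diff_left)
    qed
    show ?thesis
    proof (cases "\<delta> \<in> S")
      case True
      then have "\<exists>\<epsilon>\<in>S. cf (\<alpha> - \<delta>) \<epsilon> \<noteq> 0" using orth by (intro aux) auto
      then have "\<forall>\<epsilon>\<in>\<Delta> - S. cf (\<alpha> - \<delta>) \<epsilon> = 0" using IH by auto
      then show ?thesis using True \<delta>(1) by (auto simp: cf_diff cf_simple)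
    next
      case False
      then have "\<exists>\<epsilon>\<in>\<Delta> - S. cf (\<alpha> - \<delta>) \<epsilon> \<noteq> 0"
        using orth[THEN trans[OF inner_commute]] False \<delta>(1) by (intro aux) auto
      then have "\<forall>\<epsilon>\<in>S. cf (\<alpha> - \<delta>) \<epsilon> = 0" using IH by auto
      then show ?thesis using False \<delta>(1) by (auto simp: cf_diff cf_simple)
    qed
  qed
qed

lemma no_orthogonal_split:
  assumes "A \<union> B = \<Phi>" "A \<inter> B = {}" "A \<noteq> {}" "B \<noteq> {}" "\<And>\<alpha> \<beta>. \<alpha> \<in> A \<Longrightarrow> \<beta> \<in> B \<Longrightarrow> \<alpha> \<bullet> \<beta> = 0"
  shows False
proof -
  have "A \<noteq> {} \<and> B \<noteq> {} \<and> A \<union> B = \<Phi> \<and> A \<inter> B = {} \<and> (\<forall>\<alpha>\<in>A. \<forall>\<beta>\<in>B. \<alpha> \<bullet> \<beta> = 0)"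
    using assms by simp
  then have "\<exists>A B. A \<noteq> {} \<and> B \<noteq> {} \<and> A \<union> B = \<Phi> \<and> A \<inter> B = {} \<and> (\<forall>\<alpha>\<in>A. \<forall>\<beta>\<in>B. \<alpha> \<bullet> \<beta> = 0)"
    by (intro exI)
  then show False using irreducible unfolding irreducible_root_system_def by simp
qed

lemma base_irreducible:
  assumes "S \<subseteq> \<Delta>" "S \<noteq> {}" and orth: "\<And>\<delta> \<epsilon>. \<delta> \<in> S \<Longrightarrow> \<epsilon> \<in> \<Delta> - S \<Longrightarrow> \<delta> \<bullet> \<epsilon> = 0"
  shows "S = \<Delta>"
proof (rule ccontr)
  assume "S \<noteq> \<Delta>"
  define A where "A = {\<alpha> \<in> \<Phi>. \<forall>\<delta>\<in>\<Delta> - S. cf \<alpha> \<delta> = 0}"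
  define B where "B = {\<alpha> \<in> \<Phi>. \<forall>\<delta>\<in>S. cf \<alpha> \<delta> = 0}"
  obtain s where "s \<in> S" using assms by auto
  then have "s \<in> A" using assms by (auto simp: A_def simple_root cf_simple)
  obtain d where "d \<in> \<Delta> - S" using assms \<open>S \<noteq> \<Delta>\<close> by auto
  then have "d \<in> B" using assms by (auto simp: B_def simple_root cf_simple)
  have "\<alpha> \<in> A \<union> B" if "\<alpha> \<in> \<Phi>" for \<alpha>
    using root_sign[OF that] positive_support_split[OF assms(1) orth, of \<alpha>]
      positive_support_split[OF assms(1) orth, of "- \<alpha>"] that
    unfolding A_def B_def cf_uminus by auto
  then have "A \<union> B = \<Phi>" by (auto simp: A_def B_def)
  moreover have "A \<inter> B = {}"
  proof -
    have "x = 0" if "x \<in> A \<inter> B" for x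
      using that by (intro cf_eqI) (auto simp: A_def B_def representation_zero)
    then show ?thesis using zero_not_root by (auto simp: A_def)
  qed
  moreover have "\<alpha> \<bullet> \<beta> = 0" if "\<alpha> \<in> A" "\<beta> \<in> B" for \<alpha> \<beta>
  proof -
    have "\<beta> \<bullet> \<delta> = 0" if "\<delta> \<in> S" for \<delta>
    proof (subst inner_cf, rule sum.neutral, rule ballI)
      fix \<epsilon> assume "\<epsilon> \<in> \<Delta>"
      then show "cf \<beta> \<epsilon> * (\<epsilon> \<bullet> \<delta>) = 0"
        using \<open>\<beta> \<in> B\<close> orth[OF that, of \<epsilon>] by (cases "\<epsilon> \<in> S") (auto simp: B_def inner_commute[of \<epsilon>])
    qed
    then have "cf \<alpha> \<delta> * (\<delta> \<bullet> \<beta>) = 0" if "\<delta> \<in> \<Delta>" for \<delta>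
      using \<open>\<alpha> \<in> A\<close> that by (cases "\<delta> \<in> S") (simp_all add: A_def inner_commute[of \<delta>])
    then show ?thesis by (subst inner_cf) (rule sum.neutral, blast)
  qed
  ultimately show False
    using no_orthogonal_split[of A B] \<open>s \<in> A\<close> \<open>d \<in> B\<close> by blast
qed

section \<open>Dominant roots: full support, uniqueness, existence\<close>

definition dominant where "dominant \<gamma> \<longleftrightarrow> \<gamma> \<in> \<Phi> \<and> (\<forall>\<delta>\<in>\<Delta>. 0 \<le> \<delta> \<bullet> \<gamma>)"

lemma inner_dominant_nonneg:
  assumes "dominant \<gamma>" "\<alpha> \<in> P" shows "0 \<le> \<alpha> \<bullet> \<gamma>"
  by (subst inner_cf) (use assms cf_nonneg in \<open>auto intro!: sum_nonneg simp: dominant_def\<close>)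

lemma dominant_positive: "dominant \<gamma> \<Longrightarrow> \<gamma> \<in> P"
  using root_sign[of \<gamma>] inner_dominant_nonneg[of \<gamma> "- \<gamma>"] inner_root_self[of \<gamma>]
  by (auto simp: dominant_def)

text \<open>For d outside the support, \<gamma> \<bullet> d is nonnegative by dominance but a sum of
  nonpositive terms, because distinct simple roots have nonpositive products. All terms vanish, so
  the support is orthogonal to the rest and is the whole base.\<close>

lemma dominant_full_support:
  assumes "dominant \<gamma>" "\<delta> \<in> \<Delta>" shows "0 < cf \<gamma> \<delta>"
proof -
  define S where "S = {\<delta> \<in> \<Delta>. 0 < cf \<gamma> \<delta>}"
  note P = dominant_positive[OF assms(1)]
  have "S \<noteq> {}"
  proof
    assume "S = {}"
    then have "\<gamma> = 0"
      using cf_nonneg[OF P] by (intro cf_eqI) (simp add: S_def representation_zero not_less order.antisym)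
    then show False using assms(1) zero_not_root by (simp add: dominant_def)
  qed
  have "S = \<Delta>"
  proof (rule base_irreducible)
    fix s d assume s: "s \<in> S" and d: "d \<in> \<Delta> - S"
    have "cf \<gamma> d = 0" using d cf_nonneg[OF P, of d] by (auto simp: S_def)
    have le: "cf \<gamma> \<epsilon> * (\<epsilon> \<bullet> d) \<le> 0" if "\<epsilon> \<in> \<Delta>" for \<epsilon>
      using that inner_simple_nonpos[of \<epsilon> d] cf_nonneg[OF P that] d \<open>cf \<gamma> d = 0\<close>
      by (cases "\<epsilon> = d") (auto simp: mult_le_0_iff)
    have "0 \<le> \<gamma> \<bullet> d"
      using assms(1) d by (simp add: dominant_def inner_commute[of \<gamma> d])
    then have "0 \<le> (\<Sum>\<epsilon>\<in>\<Delta>. cf \<gamma> \<epsilon> * (\<epsilon> \<bullet> d))" by (subst (asm) inner_cf)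
    then have "(\<Sum>\<epsilon>\<in>\<Delta>. - (cf \<gamma> \<epsilon> * (\<epsilon> \<bullet> d))) = 0"
      using sum_nonpos[of \<Delta> "\<lambda>\<epsilon>. cf \<gamma> \<epsilon> * (\<epsilon> \<bullet> d)"] le by (simp add: sum_negf)
    then have "\<forall>\<epsilon>\<in>\<Delta>. - (cf \<gamma> \<epsilon> * (\<epsilon> \<bullet> d)) = 0"
      by (subst (asm) sum_nonneg_eq_0_iff) (use le finite_base in auto)
    then show "s \<bullet> d = 0" using s by (auto simp: S_def)
  qed (use \<open>S \<noteq> {}\<close> in \<open>auto simp: S_def\<close>)
  then show ?thesis using assms by (auto simp: S_def)
qed

text \<open>Full support makes the product of two dominant roots positive, so if distinct they
  differ by a root. That root has product -1 with \<eta> and its negative has product -1 with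
  \<gamma>, yet one of the two is positive.\<close>

lemma dominant_unique:
  assumes "dominant \<gamma>" "dominant \<eta>" shows "\<gamma> = \<eta>"
proof (rule ccontr)
  assume "\<gamma> \<noteq> \<eta>"
  note \<Phi> = assms[unfolded dominant_def, THEN conjunct1]
  have nonneg: "0 \<le> \<delta> \<bullet> \<eta>" if "\<delta> \<in> \<Delta>" for \<delta> using assms that by (simp add: dominant_def)
  have "0 < \<gamma> \<bullet> \<eta>"
  proof (rule ccontr)
    assume "\<not> 0 < \<gamma> \<bullet> \<eta>"
    then have "(\<Sum>\<delta>\<in>\<Delta>. cf \<gamma> \<delta> * (\<delta> \<bullet> \<eta>)) = 0"
      using inner_dominant_nonneg[OF assms(2) dominant_positive[OF assms(1)]]
        inner_cf[of \<gamma> \<eta>] by simp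
    then have "\<forall>\<delta>\<in>\<Delta>. cf \<gamma> \<delta> * (\<delta> \<bullet> \<eta>) = 0"
      by (subst (asm) sum_nonneg_eq_0_iff)
        (use nonneg cf_nonneg[OF dominant_positive[OF assms(1)]] finite_base in auto)
    then have "\<forall>\<delta>\<in>\<Delta>. \<delta> \<bullet> \<eta> = 0"
      using dominant_full_support[OF assms(1)] by (metis less_irrefl mult_eq_0_iff)
    then have "\<eta> = 0" by (intro eq_of_inner_simple) simp
    then show False using \<Phi> zero_not_root by simp
  qed
  note d = root_diff_of_inner_pos[OF \<Phi> this \<open>\<gamma> \<noteq> \<eta>\<close>]
  have "(\<gamma> - \<eta>) \<bullet> \<eta> < 0" "- (\<gamma> - \<eta>) \<bullet> \<gamma> < 0"
    using d(1) inner_root_self[OF \<Phi>(1)] inner_root_self[OF \<Phi>(2)] inner_commute[of \<gamma> \<eta>]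
    by (auto simp: inner_diff_left)
  then show False
    using root_sign[OF d(2)] inner_dominant_nonneg[OF assms(2), of "\<gamma> - \<eta>"]
      inner_dominant_nonneg[OF assms(1), of "- (\<gamma> - \<eta>)"] by linarith
qed

text \<open>Take a root of greatest height among those above \<beta>. A negative product with a
  simple root would let the reflection raise that coefficient and the height.\<close>

lemma exists_dominant_above:
  assumes "\<beta> \<in> \<Phi>" shows "\<exists>\<gamma>. dominant \<gamma> \<and> (\<forall>\<delta>\<in>\<Delta>. cf \<beta> \<delta> \<le> cf \<gamma> \<delta>)"
proof -
  define M where "M = {\<gamma> \<in> \<Phi>. \<forall>\<delta>\<in>\<Delta>. cf \<beta> \<delta> \<le> cf \<gamma> \<delta>}"
  have "finite M" "\<beta> \<in> M" using finite_roots assms by (auto simp: M_def)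
  then have "Max (ht ` M) \<in> ht ` M" by (intro Max_in) auto
  then obtain \<gamma> where \<gamma>: "\<gamma> \<in> M" "ht \<gamma> = Max (ht ` M)" by auto
  then have max: "ht \<eta> \<le> ht \<gamma>" if "\<eta> \<in> M" for \<eta> using \<open>finite M\<close> that by simp
  have "0 \<le> \<delta> \<bullet> \<gamma>" if \<delta>: "\<delta> \<in> \<Delta>" for \<delta>
  proof (rule ccontr)
    assume neg: "\<not> 0 \<le> \<delta> \<bullet> \<gamma>"
    let ?\<eta> = "\<gamma> - (\<gamma> \<bullet> \<delta>) *\<^sub>R \<delta>"
    have "?\<eta> \<in> \<Phi>" using \<gamma> \<delta> reflection_root simple_root by (auto simp: M_def)
    moreover have "cf \<gamma> \<epsilon> \<le> cf ?\<eta> \<epsilon>" for \<epsilon>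
      using neg \<delta> by (simp add: cf_diff cf_scale cf_simple inner_commute)
    ultimately have "?\<eta> \<in> M" using \<gamma>(1) unfolding M_def by (blast intro: order_trans)
    then have "ht ?\<eta> \<le> ht \<gamma>" by (rule max)
    then show False
      using neg \<delta> by (simp add: ht_eq inner_diff_left inner_simple_rho inner_commute[of \<gamma>])
  qed
  then show ?thesis using \<gamma>(1) by (auto simp: M_def dominant_def)
qed

abbreviation \<theta> where "\<theta> \<equiv> highest_root \<Phi> \<Delta>"
abbreviation h where "h \<equiv> coxeter_number \<Phi> \<Delta>"

text \<open>Every root lies below some dominant root and there is only one dominant root, so it
  dominates all roots and is the object picked by \<open>THE\<close>.\<close>

lemma
  shows highest_dominant: "dominant \<theta>"
    and cf_le_highest: "\<beta> \<in> \<Phi> \<Longrightarrow> \<delta> \<in> \<Delta> \<Longrightarrow> cf \<beta> \<delta> \<le> cf \<theta> \<delta>"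
proof -
  obtain \<beta>\<^sub>0 where "\<beta>\<^sub>0 \<in> \<Phi>" using irreducible by (auto simp: irreducible_root_system_def)
  then obtain \<gamma> where \<gamma>: "dominant \<gamma>" using exists_dominant_above by blast
  then have le: "\<forall>\<beta>\<in>\<Phi>. \<forall>\<delta>\<in>\<Delta>. cf \<beta> \<delta> \<le> cf \<gamma> \<delta>"
    using exists_dominant_above dominant_unique by metis
  have "\<theta> = \<gamma>"
    unfolding highest_root_def
  proof (rule the_equality)
    show "\<gamma> \<in> \<Phi> \<and> (\<forall>\<beta>\<in>\<Phi>. \<forall>\<delta>\<in>\<Delta>. cf \<beta> \<delta> \<le> cf \<gamma> \<delta>)" using \<gamma> le by (simp add: dominant_def)
    fix \<eta> assume "\<eta> \<in> \<Phi> \<and> (\<forall>\<beta>\<in>\<Phi>. \<forall>\<delta>\<in>\<Delta>. cf \<beta> \<delta> \<le> cf \<eta> \<delta>)"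
    then show "\<eta> = \<gamma>"
      using \<gamma> le by (intro cf_eqI) (auto simp: dominant_def intro: antisym)
  qed
  then show "dominant \<theta>" "\<beta> \<in> \<Phi> \<Longrightarrow> \<delta> \<in> \<Delta> \<Longrightarrow> cf \<beta> \<delta> \<le> cf \<theta> \<delta>"
    using \<gamma> le by auto
qed

section \<open>The Coxeter number as a bound on heights\<close>

lemma highest_positive: "\<theta> \<in> P"
  by (rule dominant_positive[OF highest_dominant])

lemma coxeter_eq: "real h = 1 + ht \<theta>"
proof -
  obtain k where k: "ht \<theta> = of_int k"
    using ht_Ints[OF positive_root[OF highest_positive]] by (auto elim: Ints_cases)
  have "\<lfloor>1 + ht \<theta>\<rfloor> = 1 + k" unfolding k by simp
  then show ?thesis
    using k ht_pos[OF highest_positive] by (simp add: coxeter_number_def)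
qed

lemma dual_coxeter_eq: "dual_coxeter_number \<Phi> \<Delta> = real h"
proof -
  have "coroot ` \<Delta> = \<Delta>" using coroot_eq simple_root by force
  then show ?thesis
    using coroot_eq[OF positive_root[OF highest_positive]]
    by (simp add: dual_coxeter_number_def coxeter_eq)
qed

lemma ht_less_coxeter: "\<alpha> \<in> \<Phi> \<Longrightarrow> ht \<alpha> \<le> real h - 1"
  unfolding coxeter_eq by (simp add: height_def sum_mono cf_le_highest)

lemma ht_uminus: "ht (- \<alpha>) = - ht \<alpha>"
  by (simp add: ht_eq)

lemma abs_ht:
  assumes "\<alpha> \<in> \<Phi>" shows "0 < \<bar>ht \<alpha>\<bar>" "\<bar>ht \<alpha>\<bar> \<le> real h - 1"
  using root_sign[OF assms] ht_pos[of \<alpha>] ht_pos[of "- \<alpha>"] ht_less_coxeter[OF assms]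
    ht_less_coxeter[OF root_uminus[OF assms]] by (auto simp: ht_uminus)

lemma coxeter_ge_2: "h \<ge> 2"
  using coxeter_eq ht_pos[OF highest_positive] by linarith

subsection \<open>The strange formula\<close>

text \<open>The sum commutes with the reflection in \<alpha>, so its value at \<alpha> is sent to
  its negative, and the -1 eigenspace of the reflection is the line of \<alpha>.\<close>

lemma sum_inner_roots_parallel:
  assumes "\<alpha> \<in> \<Phi>"
  shows "\<exists>c. (\<Sum>\<beta>\<in>\<Phi>. (\<alpha> \<bullet> \<beta>) *\<^sub>R \<beta>) = c *\<^sub>R \<alpha>"
proof -
  let ?s = "root_reflection \<alpha>" and ?U = "\<Sum>\<beta>\<in>\<Phi>. (\<alpha> \<bullet> \<beta>) *\<^sub>R \<beta>"
  have s\<alpha>: "?s \<alpha> = - \<alpha>" by (simp add: reflection_eq assms inner_root_self scaleR_2)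
  have "?s ?U = (\<Sum>\<beta>\<in>\<Phi>. (\<alpha> \<bullet> \<beta>) *\<^sub>R ?s \<beta>)"
    by (simp add: linear_sum[OF linear_reflection] linear_scale[OF linear_reflection])
  also have "\<dots> = (\<Sum>\<beta>\<in>\<Phi>. (- \<alpha> \<bullet> ?s \<beta>) *\<^sub>R ?s \<beta>)"
    using reflection_inner[OF assms, of \<alpha>] by (simp add: s\<alpha>)
  also have "\<dots> = (\<Sum>\<beta>\<in>\<Phi>. (- \<alpha> \<bullet> \<beta>) *\<^sub>R \<beta>)"
    by (rule sum.reindex_bij_betw[OF reflection_bij[OF assms]])
  also have "\<dots> = - ?U" by (simp add: sum_negf)
  finally have "2 *\<^sub>R ?U = (?U \<bullet> \<alpha>) *\<^sub>R \<alpha>"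
    by (simp add: reflection_eq[OF assms] scaleR_2 algebra_simps)
  then have "2 *\<^sub>R ?U = 2 *\<^sub>R (((?U \<bullet> \<alpha>) / 2) *\<^sub>R \<alpha>)" by simp
  then have "?U = ((?U \<bullet> \<alpha>) / 2) *\<^sub>R \<alpha>" by (simp only: scaleR_cancel_left) simp
  then show ?thesis ..
qed

text \<open>Schur's lemma by hand: every root is an eigenvector of the symmetric operator
  \<open>U\<close>, and non-orthogonal roots share an eigenvalue. Roots with different eigenvalues
  would therefore split \<open>\<Phi>\<close> orthogonally.\<close>

lemma sum_inner_roots_scalar: "\<exists>c. \<forall>x. (\<Sum>\<beta>\<in>\<Phi>. (x \<bullet> \<beta>) *\<^sub>R \<beta>) = c *\<^sub>R x"
proof -
  define U where "U x = (\<Sum>\<beta>\<in>\<Phi>. (x \<bullet> \<beta>) *\<^sub>R \<beta>)" for x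
  have lin: "linear U"
    unfolding U_def by (intro linearI) (simp_all add: inner_add_left scaleR_add_left sum.distrib scaleR_sum_right)
  have sym: "U x \<bullet> y = x \<bullet> U y" for x y
    by (simp add: U_def inner_sum_left inner_sum_right inner_commute mult.commute)
  obtain c where c: "\<And>\<alpha>. \<alpha> \<in> \<Phi> \<Longrightarrow> U \<alpha> = c \<alpha> *\<^sub>R \<alpha>"
    using sum_inner_roots_parallel unfolding U_def by metis
  have c_eq: "c \<alpha> = c \<beta>" if "\<alpha> \<in> \<Phi>" "\<beta> \<in> \<Phi>" "\<alpha> \<bullet> \<beta> \<noteq> 0" for \<alpha> \<beta>
    using sym[of \<alpha> \<beta>] that c by simp
  obtain \<alpha>\<^sub>0 where \<alpha>\<^sub>0: "\<alpha>\<^sub>0 \<in> \<Phi>" using irreducible by (auto simp: irreducible_root_system_def)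
  define A where "A = {\<alpha> \<in> \<Phi>. c \<alpha> = c \<alpha>\<^sub>0}"
  have "\<Phi> - A = {}"
  proof (rule ccontr)
    assume "\<Phi> - A \<noteq> {}"
    moreover have "A \<noteq> {}" "A \<union> (\<Phi> - A) = \<Phi>" "A \<inter> (\<Phi> - A) = {}" using \<alpha>\<^sub>0 by (auto simp: A_def)
    moreover have "\<alpha> \<bullet> \<beta> = 0" if "\<alpha> \<in> A" "\<beta> \<in> \<Phi> - A" for \<alpha> \<beta>
    proof (rule ccontr)
      assume "\<alpha> \<bullet> \<beta> \<noteq> 0"
      then show False using c_eq[of \<alpha> \<beta>] that by (simp add: A_def)
    qed
    ultimately show False using no_orthogonal_split[of A "\<Phi> - A"] by blast
  qed
  then have "U \<alpha> = c \<alpha>\<^sub>0 *\<^sub>R \<alpha>" if "\<alpha> \<in> \<Phi>" for \<alpha> using c that by (auto simp: A_def)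
  then have "U x = c \<alpha>\<^sub>0 *\<^sub>R x" for x
    using linear_eq_on[OF lin linear_scale_self, of x \<Phi>] span_roots by auto
  then show ?thesis by (auto simp: U_def)
qed

text \<open>The products of \<open>\<theta>\<close> with the other positive roots are 0 or 1 and
  equal their squares; at \<open>\<theta>\<close> itself 4 = 2 + 2. The total is 2
  \<open>ht \<theta>\<close> + 2.\<close>

lemma sum_inner_highest: "(\<Sum>\<beta>\<in>P. (\<theta> \<bullet> \<beta>)\<^sup>2) = 2 * real h"
proof -
  note \<Phi> = positive_root[OF highest_positive]
  have *: "(\<theta> \<bullet> \<beta>)\<^sup>2 = \<theta> \<bullet> \<beta> + (if \<beta> = \<theta> then 2 else 0)" if "\<beta> \<in> P" for \<beta>
  proof (cases "\<beta> = \<theta>")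
    case False
    have "\<theta> \<bullet> \<beta> \<ge> 0"
      using inner_dominant_nonneg[OF highest_dominant that] by (simp add: inner_commute)
    moreover have "\<theta> \<noteq> - \<beta>"
      using uminus_not_positive[OF that] highest_positive by metis
    ultimately show ?thesis
      using inner_roots_cases[OF \<Phi> positive_root[OF that]] False by auto
  qed (simp add: inner_root_self[OF \<Phi>])
  have "(\<Sum>\<beta>\<in>P. (\<theta> \<bullet> \<beta>)\<^sup>2) = (\<Sum>\<beta>\<in>P. \<theta> \<bullet> \<beta>) + (\<Sum>\<beta>\<in>P. if \<beta> = \<theta> then 2 else 0)"
    by (simp add: * sum.distrib)
  also have "(\<Sum>\<beta>\<in>P. \<theta> \<bullet> \<beta>) = 2 * ht \<theta>"
    by (simp add: ht_eq flip: inner_sum_right two_rho)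
  also have "(\<Sum>\<beta>\<in>P. if \<beta> = \<theta> then 2 else 0) = (2::real)"
    using finite_positive highest_positive by simp
  finally show ?thesis by (simp add: coxeter_eq)
qed

lemma sum_inner_positive: "(\<Sum>\<beta>\<in>P. (x \<bullet> \<beta>) *\<^sub>R \<beta>) = real h *\<^sub>R x"
proof -
  obtain c where c: "\<And>x. (\<Sum>\<beta>\<in>\<Phi>. (x \<bullet> \<beta>) *\<^sub>R \<beta>) = c *\<^sub>R x" using sum_inner_roots_scalar by blast
  have half: "2 *\<^sub>R (\<Sum>\<beta>\<in>P. (x \<bullet> \<beta>) *\<^sub>R \<beta>) = c *\<^sub>R x" for x
    using c[of x] by (simp add: sum_roots scaleR_2)
  have "2 * (\<Sum>\<beta>\<in>P. (\<theta> \<bullet> \<beta>)\<^sup>2) = (2 *\<^sub>R (\<Sum>\<beta>\<in>P. (\<theta> \<bullet> \<beta>) *\<^sub>R \<beta>)) \<bullet> \<theta>"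
    by (simp add: inner_sum_left power2_eq_square inner_commute[of \<theta>])
  also have "\<dots> = 2 * c"
    by (simp add: half inner_root_self[OF positive_root[OF highest_positive]])
  finally have "c = 2 * real h" by (simp add: sum_inner_highest)
  then have "2 *\<^sub>R (\<Sum>\<beta>\<in>P. (x \<bullet> \<beta>) *\<^sub>R \<beta>) = 2 *\<^sub>R (real h *\<^sub>R x)" by (simp add: half)
  then show ?thesis by (simp only: scaleR_cancel_left) simp
qed

lemma sum_inner_sq: "(\<Sum>\<beta>\<in>P. (x \<bullet> \<beta>)\<^sup>2) = real h * (x \<bullet> x)"
proof -
  have "(\<Sum>\<beta>\<in>P. (x \<bullet> \<beta>)\<^sup>2) = (\<Sum>\<beta>\<in>P. (x \<bullet> \<beta>) *\<^sub>R \<beta>) \<bullet> x"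
    by (simp add: inner_sum_left power2_eq_square inner_commute[of x])
  then show ?thesis by (simp add: sum_inner_positive)
qed

text \<open>A trace computation: sum \<open>sum_inner_sq\<close> over an orthonormal basis, each
  root contributing its squared length 2.\<close>

lemma card_positive: "2 * real (card P) = real DIM('a) * real h"
proof -
  have "2 * real (card P) = (\<Sum>\<beta>\<in>P. \<beta> \<bullet> \<beta>)"
    using inner_root_self positive_root by simp
  also have "\<dots> = (\<Sum>\<beta>\<in>P. \<Sum>b\<in>Basis. (b \<bullet> \<beta>)\<^sup>2)"
    by (subst euclidean_inner) (simp add: power2_eq_square inner_commute)
  also have "\<dots> = (\<Sum>b\<in>(Basis :: 'a set). \<Sum>\<beta>\<in>P. (b \<bullet> \<beta>)\<^sup>2)" by (rule sum.swap)
  also have "\<dots> = real DIM('a) * real h" by (simp add: sum_inner_sq)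
  finally show ?thesis .
qed

text \<open>The difference of two positive roots with inner product 1 is a root, positive in exactly
  one of the two orders.\<close>

lemma card_inner_one:
  "card {(\<alpha>, \<beta>) \<in> P \<times> P. \<alpha> \<bullet> \<beta> = 1} = 2 * card {(\<alpha>, \<beta>) \<in> P \<times> P. \<alpha> \<bullet> \<beta> = -1}"
proof -
  define M where "M = {(\<alpha>, \<beta>) \<in> P \<times> P. \<alpha> \<bullet> \<beta> = -1}"
  define L where "L = {(\<alpha>, \<beta>) \<in> P \<times> P. \<alpha> \<bullet> \<beta> = 1 \<and> \<alpha> - \<beta> \<in> P}"
  have "finite L"
    by (rule finite_subset[of _ "P \<times> P"]) (use finite_positive in \<open>auto simp: L_def\<close>)
  \<comment> \<open>If \<alpha> \<bullet> \<beta> = -1 then (\<alpha> + \<beta>) \<bullet> \<beta> =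
    1, and the new pair has the positive root \<alpha> as its difference.\<close>
  have "bij_betw (\<lambda>(\<alpha>, \<beta>). (\<alpha> + \<beta>, \<beta>)) M L"
  proof (rule bij_betw_byWitness[where f'="\<lambda>(\<alpha>, \<beta>). (\<alpha> - \<beta>, \<beta>)"])
    have "(\<alpha> + \<beta>, \<beta>) \<in> L" if "(\<alpha>, \<beta>) \<in> M" for \<alpha> \<beta>
    proof -
      have "\<alpha> + \<beta> \<in> P"
        using that root_add[of \<alpha> \<beta>] by (auto simp: M_def positive_roots_def cf_add)
      then show ?thesis
        using that inner_root_self[OF positive_root, of \<beta>] by (auto simp: M_def L_def inner_add_left)
    qed
    then show "(\<lambda>(\<alpha>, \<beta>). (\<alpha> + \<beta>, \<beta>)) ` M \<subseteq> L" by auto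
    have "(\<alpha> - \<beta>, \<beta>) \<in> M" if "(\<alpha>, \<beta>) \<in> L" for \<alpha> \<beta>
      using that inner_root_self[OF positive_root, of \<beta>] by (auto simp: M_def L_def inner_diff_left)
    then show "(\<lambda>(\<alpha>, \<beta>). (\<alpha> - \<beta>, \<beta>)) ` L \<subseteq> M" by auto
  qed auto
  then have card_L: "card L = card M" by (simp add: bij_betw_same_card)
  have card_swap: "card (prod.swap ` L) = card L"
    by (rule card_image) (auto simp: inj_on_def)
  have sign: "\<alpha> - \<beta> \<in> P \<or> \<beta> - \<alpha> \<in> P" if "\<alpha> \<in> P" "\<beta> \<in> P" "\<alpha> \<bullet> \<beta> = 1" for \<alpha> \<beta>
    using root_sign[OF root_diff[OF positive_root[OF that(1)] positive_root[OF that(2)] that(3)]]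
    by simp
  have "{(\<alpha>, \<beta>) \<in> P \<times> P. \<alpha> \<bullet> \<beta> = 1} = L \<union> prod.swap ` L"
  proof -
    have "(\<alpha>, \<beta>) \<in> L \<union> prod.swap ` L" if "\<alpha> \<in> P" "\<beta> \<in> P" "\<alpha> \<bullet> \<beta> = 1" for \<alpha> \<beta>
    proof (cases "\<alpha> - \<beta> \<in> P")
      case True
      then show ?thesis using that by (simp add: L_def)
    next
      case False
      then have "(\<beta>, \<alpha>) \<in> L"
        using sign[OF that] that unfolding L_def by (simp add: inner_commute[of \<beta>])
      then show ?thesis using imageI[of "(\<beta>, \<alpha>)" L prod.swap] by simp
    qed
    moreover have "\<alpha> \<in> P \<and> \<beta> \<in> P \<and> \<alpha> \<bullet> \<beta> = 1" if "(\<alpha>, \<beta>) \<in> L \<union> prod.swap ` L" for \<alpha> \<beta>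
    proof -
      have "(\<alpha>, \<beta>) \<in> L \<or> (\<beta>, \<alpha>) \<in> L" using that by auto
      then show ?thesis using inner_commute[of \<alpha> \<beta>] unfolding L_def by auto
    qed
    ultimately show ?thesis by (intro subset_antisym subrelI) blast+
  qed
  moreover have "L \<inter> prod.swap ` L = {}"
  proof -
    have False if "(\<alpha>, \<beta>) \<in> L" "(\<beta>, \<alpha>) \<in> L" for \<alpha> \<beta>
      using that uminus_not_positive[of "\<alpha> - \<beta>"] by (simp add: L_def)
    then show ?thesis by (force simp: image_iff)
  qed
  ultimately show ?thesis
    using \<open>finite L\<close> card_L card_swap by (simp add: card_Un_disjoint M_def)
qed

text \<open>Write N for the number of positive roots, and L, M for the numbers of ordered pairs with
  product 1 and -1. Summing products over all pairs gives 4 |\<rho>|^2 = L - M + 2N, summing squares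
  gives 2hN = L + M + 4N, and L = 2M. Eliminating L and M leaves 12 |\<rho>|^2 = 2N(h + 1), where 2N
  is the dimension times h.\<close>

lemma strange_formula: "12 * (\<rho> \<bullet> \<rho>) = real DIM('a) * real h * (real h + 1)"
proof -
  define L where "L = {(\<alpha>, \<beta>) \<in> P \<times> P. \<alpha> \<bullet> \<beta> = 1}"
  define M where "M = {(\<alpha>, \<beta>) \<in> P \<times> P. \<alpha> \<bullet> \<beta> = -1}"
  define N where "N = real (card P)"
  have sub: "L \<subseteq> P \<times> P" "M \<subseteq> P \<times> P" by (auto simp: L_def M_def)
  \<comment> \<open>Indicator form turns both double sums into cardinalities; the diagonal carries
    2, respectively 4.\<close>
  have cases: "\<alpha> \<bullet> \<beta> = of_bool ((\<alpha>, \<beta>) \<in> L) - of_bool ((\<alpha>, \<beta>) \<in> M) + (if \<alpha> = \<beta> then 2 else 0)"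
    "(\<alpha> \<bullet> \<beta>)\<^sup>2 = of_bool ((\<alpha>, \<beta>) \<in> L) + of_bool ((\<alpha>, \<beta>) \<in> M) + (if \<alpha> = \<beta> then 4 else 0)"
    if "\<alpha> \<in> P" "\<beta> \<in> P" for \<alpha> \<beta>
  proof -
    have "\<alpha> \<noteq> - \<beta>" using that uminus_not_positive by metis
    then have "\<alpha> = \<beta> \<or> \<alpha> \<bullet> \<beta> = -1 \<or> \<alpha> \<bullet> \<beta> = 0 \<or> \<alpha> \<bullet> \<beta> = 1"
      using inner_roots_cases positive_root that by metis
    then show "\<alpha> \<bullet> \<beta> = of_bool ((\<alpha>, \<beta>) \<in> L) - of_bool ((\<alpha>, \<beta>) \<in> M) + (if \<alpha> = \<beta> then 2 else 0)"
      "(\<alpha> \<bullet> \<beta>)\<^sup>2 = of_bool ((\<alpha>, \<beta>) \<in> L) + of_bool ((\<alpha>, \<beta>) \<in> M) + (if \<alpha> = \<beta> then 4 else 0)"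
      using that inner_root_self[OF positive_root[OF that(1)]]
        inner_root_self[OF positive_root[OF that(2)]]
      by (auto simp: L_def M_def)
  qed
  have count: "(\<Sum>\<alpha>\<in>P. \<Sum>\<beta>\<in>P. of_bool ((\<alpha>, \<beta>) \<in> X)) = real (card X)" if "X \<subseteq> P \<times> P" for X
  proof -
    have "(\<Sum>\<alpha>\<in>P. \<Sum>\<beta>\<in>P. of_bool ((\<alpha>, \<beta>) \<in> X)) = (\<Sum>x\<in>P \<times> P. of_bool (x \<in> X) :: real)"
      by (simp add: sum.cartesian_product split_def del: sum_of_bool_eq)
    also have "\<dots> = real (card X)"
      using that finite_positive by (simp add: Int_absorb1)
    finally show ?thesis .
  qed
  have diag: "(\<Sum>\<alpha>\<in>P. \<Sum>\<beta>\<in>P. if \<alpha> = \<beta> then c else 0) = c * N" for c :: real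
    using finite_positive by (simp add: N_def)
  have "4 * (\<rho> \<bullet> \<rho>) = (2 *\<^sub>R \<rho>) \<bullet> (2 *\<^sub>R \<rho>)" by simp
  also have "\<dots> = (\<Sum>\<alpha>\<in>P. \<Sum>\<beta>\<in>P. \<alpha> \<bullet> \<beta>)"
    unfolding two_rho inner_sum_left by (simp add: inner_sum_right)
  also have "\<dots> = real (card L) - real (card M) + 2 * N"
    by (simp add: cases(1) sum.distrib sum_subtractf diag count sub)
  finally have 1: "4 * (\<rho> \<bullet> \<rho>) = real (card L) - real (card M) + 2 * N" .
  have "(\<Sum>\<alpha>\<in>P. \<Sum>\<beta>\<in>P. (\<alpha> \<bullet> \<beta>)\<^sup>2) = real h * 2 * N"
    by (simp add: sum_inner_sq inner_root_self positive_root N_def)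
  moreover have "(\<Sum>\<alpha>\<in>P. \<Sum>\<beta>\<in>P. (\<alpha> \<bullet> \<beta>)\<^sup>2) = real (card L) + real (card M) + 4 * N"
    by (simp add: cases(2) sum.distrib diag count sub)
  moreover have "real (card L) = 2 * real (card M)"
    using card_inner_one by (simp add: L_def M_def)
  ultimately have "12 * (\<rho> \<bullet> \<rho>) = 2 * N * (real h + 1)"
    using 1 by (simp add: algebra_simps)
  then show ?thesis using card_positive by (simp add: N_def)
qed

subsection \<open>The root lattice\<close>

abbreviation Q where "Q \<equiv> coroot_lattice \<Phi>"

lemma lattice_eq: "Q = group_closure \<Phi>"
  using coroot_eq by (simp add: coroot_lattice_def)

lemma lattice_root: "\<alpha> \<in> \<Phi> \<Longrightarrow> \<alpha> \<in> Q"
  by (simp add: lattice_eq group_closure.base)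

lemma lattice_zero: "0 \<in> Q"
  and lattice_diff: "x \<in> Q \<Longrightarrow> y \<in> Q \<Longrightarrow> x - y \<in> Q"
  and lattice_add: "x \<in> Q \<Longrightarrow> y \<in> Q \<Longrightarrow> x + y \<in> Q"
  by (simp_all add: lattice_eq group_closure.diff group_closure_add)

lemma lattice_sum: "(\<And>i. i \<in> I \<Longrightarrow> f i \<in> Q) \<Longrightarrow> sum f I \<in> Q"
  by (induction I rule: infinite_finite_induct) (auto simp: lattice_zero lattice_add)

lemma lattice_scale_nat: "x \<in> Q \<Longrightarrow> real k *\<^sub>R x \<in> Q"
  by (induction k) (auto simp: lattice_zero lattice_add scaleR_add_left)

lemma lattice_scale:
  assumes "x \<in> Q" "k \<in> \<int>" shows "k *\<^sub>R x \<in> Q"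
proof -
  obtain m where m: "k = of_int m" using assms by (auto elim: Ints_cases)
  show ?thesis
  proof (cases "m \<ge> 0")
    case True
    then show ?thesis using lattice_scale_nat[OF assms(1), of "nat m"] m by simp
  next
    case False
    then show ?thesis
      using lattice_diff[OF lattice_zero lattice_scale_nat[OF assms(1), of "nat (- m)"]] m by simp
  qed
qed

lemma inner_lattice_root:
  assumes "x \<in> Q" "\<alpha> \<in> \<Phi>" shows "x \<bullet> \<alpha> \<in> \<int>"
  using assms(1) unfolding lattice_eq
  by induction (use assms(2) in \<open>auto simp: inner_roots_Ints inner_diff_left\<close>)

lemma inner_lattice:
  assumes "x \<in> Q" "y \<in> Q" shows "x \<bullet> y \<in> \<int>"
  using assms(2) unfolding lattice_eq
  by induction (use assms(1) in \<open>auto simp: inner_lattice_root inner_diff_right\<close>)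

lemma two_rho_lattice: "2 *\<^sub>R \<rho> \<in> Q"
  unfolding two_rho by (intro lattice_sum lattice_root positive_root)

text \<open>Since -\<open>\<Phi>\<close> = \<open>\<Phi>\<close>, differences are sums of roots. A
  multiset allows repeated summands, and its size is the length to be minimized.\<close>

lemma lattice_multiset:
  assumes "x \<in> Q" shows "\<exists>M. set_mset M \<subseteq> \<Phi> \<and> sum_mset M = x"
  using assms unfolding lattice_eq
proof induction
  case (base s)
  then consider "s = 0" | "s \<in> \<Phi>" by auto
  then show ?case
  proof cases
    case 1 then show ?thesis by (intro exI[of _ "{#}"]) simp
  next
    case 2 then show ?thesis by (intro exI[of _ "{#s#}"]) simp
  qed
next
  case (diff s t)
  then obtain M N where MN: "set_mset M \<subseteq> \<Phi>" "sum_mset M = s" "set_mset N \<subseteq> \<Phi>" "sum_mset N = t"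
    by auto
  have "sum_mset (image_mset uminus N) = - sum_mset N" by (induction N) auto
  then show ?case using MN root_uminus
    by (intro exI[of _ "M + image_mset uminus N"]) auto
qed

text \<open>In a shortest expression as a sum of roots no two summands have negative inner product.\<close>

lemma minuscule_lattice_zero:
  assumes "x \<in> Q" and le: "\<And>\<alpha>. \<alpha> \<in> \<Phi> \<Longrightarrow> x \<bullet> \<alpha> \<le> 1"
  shows "x = 0"
proof -
  define R where "R M \<longleftrightarrow> set_mset M \<subseteq> \<Phi> \<and> sum_mset M = x" for M
  obtain M where M: "R M" and min: "\<And>N. R N \<Longrightarrow> size M \<le> size N"
    using lattice_multiset[OF assms(1)] ex_has_least_nat[of R _ size] unfolding R_def by metis
  show ?thesis
  proof (cases "M = {#}")
    case True
    then show ?thesis using M by (simp add: R_def)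
  next
    case False
    then obtain \<beta> N where N: "M = add_mset \<beta> N" by (meson multiset_cases)
    have \<beta>: "\<beta> \<in> \<Phi>" using M N by (simp add: R_def)
    have nonneg: "0 \<le> \<gamma> \<bullet> \<beta>" if \<gamma>: "\<gamma> \<in># N" for \<gamma>
    proof (rule ccontr)
      assume neg: "\<not> 0 \<le> \<gamma> \<bullet> \<beta>"
      obtain N' where N': "N = add_mset \<gamma> N'" using \<gamma> by (meson mset_add)
      have "\<gamma> \<in> \<Phi>" using M N N' by (simp add: R_def)
      have "\<gamma> \<noteq> - \<beta>"
      proof
        assume "\<gamma> = - \<beta>"
        then have "R N'" using M N N' by (simp add: R_def)
        then show False using min[of N'] N N' by simp
      qed
      then have "\<gamma> + \<beta> \<in> \<Phi>"

        using inner_roots_cases[OF \<open>\<gamma> \<in> \<Phi>\<close> \<beta>] neg inner_root_self[OF \<beta>] root_add[OF \<open>\<gamma> \<in> \<Phi>\<close> \<beta>]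
        by (cases "\<gamma> = \<beta>") auto
      then have "R (add_mset (\<gamma> + \<beta>) N')" using M N N' by (simp add: R_def algebra_simps)
      then show False using min[of "add_mset (\<gamma> + \<beta>) N'"] N N' by simp
    qed
    \<comment> \<open>The summand \<beta> alone contributes 2 and the others contribute nothing
      negative, against the bound 1.\<close>
    have "0 \<le> sum_mset N \<bullet> \<beta>"
      using nonneg by (induction N) (auto simp: inner_add_left)
    then have "x \<bullet> \<beta> \<ge> 2"
      using M N inner_root_self[OF \<beta>] by (auto simp: R_def inner_add_left)
    then show ?thesis using le[OF \<beta>] by simp
  qed
qed

subsection \<open>The affine map onto the Sommers region\<close>

text \<open>Stands in for the Weyl group. The properties used are isometry, preservation of
  \<open>\<Phi>\<close>, and closure under composition with reflections.\<close>

definition root_automorphism where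
  "root_automorphism w \<longleftrightarrow> linear w \<and> (\<forall>x y. w x \<bullet> w y = x \<bullet> y) \<and> w ` \<Phi> = \<Phi>"

lemma automorphism_id: "root_automorphism (\<lambda>x. x)"
  by (simp add: root_automorphism_def linearI)

lemma automorphism_reflection:
  assumes "root_automorphism w" "\<alpha> \<in> \<Phi>"
  shows "root_automorphism (\<lambda>x. root_reflection \<alpha> (w x))"
proof -
  have "(\<lambda>x. root_reflection \<alpha> (w x)) ` \<Phi> = root_reflection \<alpha> ` w ` \<Phi>" by (simp add: image_image)
  also have "\<dots> = \<Phi>"
    using assms reflection_bij[OF assms(2)] by (simp add: root_automorphism_def bij_betw_def)
  finally show ?thesis
    using assms linear_compose[OF _ linear_reflection, of w \<alpha>]
    by (simp add: root_automorphism_def reflection_inner o_def)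
qed

lemma automorphism_root: "root_automorphism w \<Longrightarrow> \<alpha> \<in> \<Phi> \<Longrightarrow> w \<alpha> \<in> \<Phi>"
  by (auto simp: root_automorphism_def)

lemma automorphism_root_preimage:
  assumes "root_automorphism w" "\<alpha> \<in> \<Phi>" obtains \<beta> where "\<beta> \<in> \<Phi>" "w \<beta> = \<alpha>"
proof -
  have "\<alpha> \<in> w ` \<Phi>" using assms by (simp add: root_automorphism_def)
  then show thesis using that by blast
qed

lemma automorphism_lattice:
  assumes "root_automorphism w" shows "w ` Q = Q"
proof -
  have lin: "linear w" and im: "w ` \<Phi> = \<Phi>" using assms by (auto simp: root_automorphism_def)
  have "\<exists>x\<in>Q. w x = y" if "y \<in> Q" for y
    using that unfolding lattice_eq
  proof induction
    case (base s)
    show ?case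
    proof (cases "s = 0")
      case True
      then show ?thesis using linear_0[OF lin] by (intro bexI[of _ 0]) simp_all
    next
      case False
      then have "s \<in> w ` \<Phi>" using base im by simp
      then obtain \<alpha> where "\<alpha> \<in> \<Phi>" "w \<alpha> = s" by blast
      then show ?thesis using group_closure.base[of \<alpha> \<Phi>] by (intro bexI[of _ \<alpha>]) simp_all
    qed
  next
    case (diff s t)
    then obtain x y where xy: "x \<in> group_closure \<Phi>" "y \<in> group_closure \<Phi>" "w x = s" "w y = t"
      by blast
    then have "w (x - y) = s - t" using linear_diff[OF lin] by simp
    then show ?case using group_closure.diff[OF xy(1,2)] by (intro bexI)
  qed
  moreover have "w x \<in> Q" if "x \<in> Q" for x
    using that unfolding lattice_eq
  proof induction
    case (base s)
    then have "w s \<in> insert 0 \<Phi>" using imageI[of s \<Phi> w] linear_0[OF lin] unfolding im by auto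
    then show ?case by (rule group_closure.base)
  next
    case (diff s t)
    then show ?case by (simp add: linear_diff[OF lin] group_closure.diff)
  qed
  ultimately show ?thesis by blast
qed

text \<open>Says that b \<rho>/h lies on no affine wall: coprimality would force h to divide a
  nonzero height of absolute value below h.\<close>

lemma scaled_ht_not_Ints:
  assumes "\<alpha> \<in> \<Phi>" "coprime h b" shows "real b * ht \<alpha> / real h \<notin> \<int>"
proof
  assume "real b * ht \<alpha> / real h \<in> \<int>"
  then obtain m where m: "real b * ht \<alpha> / real h = of_int m" by (auto elim: Ints_cases)
  obtain k where k: "ht \<alpha> = of_int k" using ht_Ints[OF assms(1)] by (auto elim: Ints_cases)
  have "real_of_int (int b * k) = of_int (int h * m)"
    using m k coxeter_ge_2 by (simp add: field_simps)
  then have "int b * k = int h * m" by linarith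
  then have "int h dvd int b * k" by simp
  then have "int h dvd k"
    using assms(2) by (simp add: coprime_dvd_mult_right_iff)
  moreover have "0 < \<bar>k\<bar>" "\<bar>k\<bar> < int h" using abs_ht[OF assms(1)] k by linarith+
  ultimately show False using zdvd_imp_le[of "int h" "\<bar>k\<bar>"] by simp
qed

text \<open>The alcove containing \<open>b \<rho> / h\<close> is moved to the fundamental alcove by choosing the image
  of the point nearest to \<open>\<rho> / h\<close>. The interior of the fundamental alcove contains no
  other point whose inner products with the roots lie in \<open>\<int> / h\<close>.\<close>

lemma exists_affine_map:
  assumes "coprime h b"
  shows "\<exists>w q. root_automorphism w \<and> q \<in> Q \<and>
    w ((real b / real h) *\<^sub>R \<rho>) + q = (1 / real h) *\<^sub>R \<rho>"
proof -
  define x where "x = (real b / real h) *\<^sub>R \<rho>"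
  define c where "c = (1 / real h) *\<^sub>R \<rho>"
  define v where "v = (\<lambda>(w, q). w x + q - c)"
  define C where "C = {(w, q). root_automorphism w \<and> q \<in> Q}"
  have h0: "real h > 0" using coxeter_ge_2 by simp
  \<comment> \<open>Only 2 \<rho>, not \<rho>, is known to lie in the lattice, hence the factor 2h
    on \<open>v p\<close>. Squared distances times 4h^2 are then natural numbers, so a nearest image
    exists.\<close>
  define N where "N p = nat \<lfloor>4 * (real h)\<^sup>2 * (v p \<bullet> v p)\<rfloor>" for p
  have N: "real (N p) = 4 * (real h)\<^sup>2 * (v p \<bullet> v p)" if "p \<in> C" for p
  proof -
    obtain w q where p: "p = (w, q)" by force
    have w: "linear w" "root_automorphism w" and "q \<in> Q"
      using that p by (auto simp: C_def root_automorphism_def)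
    have "(2 * real h) *\<^sub>R v p = real b *\<^sub>R w (2 *\<^sub>R \<rho>) + (2 * real h) *\<^sub>R q - 2 *\<^sub>R \<rho>"
      using h0 by (simp add: p v_def x_def c_def linear_scale[OF w(1)] algebra_simps)
    also have "\<dots> \<in> Q"
    proof -
      have "w (2 *\<^sub>R \<rho>) \<in> Q" using automorphism_lattice[OF w(2)] two_rho_lattice by blast
      then show ?thesis
        using \<open>q \<in> Q\<close> by (intro lattice_diff lattice_add two_rho_lattice) (auto intro: lattice_scale)
    qed
    finally have "((2 * real h) *\<^sub>R v p) \<bullet> ((2 * real h) *\<^sub>R v p) \<in> \<int>"
      using inner_lattice by blast
    then have "4 * (real h)\<^sup>2 * (v p \<bullet> v p) \<in> \<int>" by (simp add: power2_eq_square mult_ac)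
    then obtain k where "4 * (real h)\<^sup>2 * (v p \<bullet> v p) = of_int k" by (auto elim: Ints_cases)
    moreover have "0 \<le> 4 * (real h)\<^sup>2 * (v p \<bullet> v p)" by simp
    ultimately show ?thesis by (simp add: N_def)
  qed
  have "(\<lambda>x. x, 0) \<in> C" by (simp add: C_def automorphism_id lattice_zero)
  then obtain p where p: "p \<in> C" "\<And>p'. p' \<in> C \<Longrightarrow> N p \<le> N p'"
    using ex_has_least_nat[of "\<lambda>p. p \<in> C" _ N] by metis
  obtain w q where wq: "p = (w, q)" by force
  have w: "linear w" "root_automorphism w" "w ` \<Phi> = \<Phi>" "\<And>x y. w x \<bullet> w y = x \<bullet> y" and q: "q \<in> Q"
    using p(1) wq by (auto simp: C_def root_automorphism_def)
  define z where "z = w x + q"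
  have vz: "v p = z - c" by (simp add: wq v_def z_def)
  have min: "v p \<bullet> v p \<le> v p' \<bullet> v p'" if "p' \<in> C" for p'
  proof -
    have "4 * (real h)\<^sup>2 * (v p \<bullet> v p) \<le> 4 * (real h)\<^sup>2 * (v p' \<bullet> v p')"
      using N[OF p(1)] N[OF that] p(2)[OF that] by linarith
    then show ?thesis using h0 by simp
  qed
  \<comment> \<open>\<open>?p\<close> below is \<open>p\<close> followed by the reflection in the
    wall where the product with \<alpha> is k. It brings the image no closer to \<open>c\<close>, so
    \<open>z\<close> and \<open>c\<close> are on the same side of the wall, in the weak
    sense.\<close>
  have same_side: "0 \<le> (z \<bullet> \<alpha> - of_int k) * (ht \<alpha> / real h - of_int k)" if \<alpha>: "\<alpha> \<in> \<Phi>" for \<alpha> k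
  proof -
    let ?p = "(\<lambda>x. root_reflection \<alpha> (w x), root_reflection \<alpha> q + of_int k *\<^sub>R \<alpha>)"
    define a where "a = z \<bullet> \<alpha> - of_int k"
    have "root_reflection \<alpha> q \<in> Q"
      using lattice_diff[OF q lattice_scale[OF lattice_root[OF \<alpha>] inner_lattice_root[OF q \<alpha>]]]
      by (simp add: reflection_eq[OF \<alpha>])
    then have "?p \<in> C"
      using automorphism_reflection[OF w(2) \<alpha>] \<alpha>
        lattice_add[OF \<open>root_reflection \<alpha> q \<in> Q\<close> lattice_scale[OF lattice_root[OF \<alpha>]]]
      by (simp add: C_def)
    then have "v p \<bullet> v p \<le> v ?p \<bullet> v ?p" by (rule min)
    moreover have "v ?p = v p - a *\<^sub>R \<alpha>"
      by (simp add: v_def wq reflection_eq[OF \<alpha>] a_def z_def inner_add_left algebra_simps)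
    moreover have "v p \<bullet> \<alpha> = a + of_int k - ht \<alpha> / real h"
      by (simp add: vz inner_diff_left a_def c_def ht_eq inner_commute[of \<alpha> \<rho>])
    moreover have "(v p - a *\<^sub>R \<alpha>) \<bullet> (v p - a *\<^sub>R \<alpha>) = v p \<bullet> v p - 2 * a * (v p \<bullet> \<alpha>) + 2 * a * a"
      using inner_root_self[OF \<alpha>]
      by (simp add: inner_diff_left inner_diff_right inner_commute[of \<alpha> "v p"] algebra_simps)
    ultimately have "0 \<le> - (2 * a * (a + of_int k - ht \<alpha> / real h)) + 2 * a * a" by simp
    also have "\<dots> = 2 * (a * (ht \<alpha> / real h - of_int k))" by (simp add: algebra_simps)
    finally show ?thesis by (simp add: a_def)
  qed
  \<comment> \<open>Being off the walls makes the inequalities strict; being a multiple of 1/h then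
    sharpens them by 1/h.\<close>
  have z_inner: "z \<bullet> \<alpha> \<notin> \<int>" "real h * (z \<bullet> \<alpha>) \<in> \<int>" if \<alpha>: "\<alpha> \<in> \<Phi>" for \<alpha>
  proof -
    obtain \<beta> where \<beta>: "\<beta> \<in> \<Phi>" "w \<beta> = \<alpha>" using automorphism_root_preimage[OF w(2) \<alpha>] .
    have "w x \<bullet> \<alpha> = real b * ht \<beta> / real h"
      using w(4)[of x \<beta>] by (simp add: \<beta>(2) x_def ht_eq inner_commute[of \<beta> \<rho>])
    then have eq: "z \<bullet> \<alpha> = real b * ht \<beta> / real h + q \<bullet> \<alpha>"
      by (simp add: z_def inner_add_left)
    have q\<alpha>: "q \<bullet> \<alpha> \<in> \<int>" using inner_lattice_root q \<alpha> by simp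
    show "z \<bullet> \<alpha> \<notin> \<int>"
    proof
      assume "z \<bullet> \<alpha> \<in> \<int>"
      then have "z \<bullet> \<alpha> - q \<bullet> \<alpha> \<in> \<int>" using q\<alpha> by (rule Ints_diff)
      then show False using scaled_ht_not_Ints[OF \<beta>(1) assms] by (simp add: eq)
    qed
    have "real b * ht \<beta> + real h * (q \<bullet> \<alpha>) \<in> \<int>"
      by (intro Ints_add Ints_mult q\<alpha> ht_Ints[OF \<beta>(1)] Ints_of_nat)
    then show "real h * (z \<bullet> \<alpha>) \<in> \<int>" using h0 by (simp add: eq distrib_left)
  qed
  have simple: "1 \<le> real h * (\<delta> \<bullet> z)" if "\<delta> \<in> \<Delta>" for \<delta>
  proof -
    have "\<delta> \<in> \<Phi>" "ht \<delta> = 1" using that by (auto simp: simple_root ht_eq inner_simple_rho)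
    then have "0 \<le> z \<bullet> \<delta>" using same_side[of \<delta> 0] h0 by (simp add: zero_le_mult_iff zero_le_divide_iff)
    moreover have "z \<bullet> \<delta> \<noteq> 0" using z_inner(1)[OF \<open>\<delta> \<in> \<Phi>\<close>] by auto
    ultimately have "0 < real h * (z \<bullet> \<delta>)" using h0 by simp
    then show ?thesis using z_inner(2)[OF \<open>\<delta> \<in> \<Phi>\<close>] by (auto elim!: Ints_cases simp: inner_commute[of \<delta>])
  qed
  have "real h * (z \<bullet> \<theta>) \<le> real h - 1"
  proof -
    note \<theta> = positive_root[OF highest_positive]
    have "ht \<theta> / real h - 1 < 0" using h0 coxeter_eq by simp
    then have "z \<bullet> \<theta> \<le> 1" using same_side[OF \<theta>, of 1] by (simp add: zero_le_mult_iff)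
    moreover have "z \<bullet> \<theta> \<noteq> 1" using z_inner(1)[OF \<theta>] by auto
    ultimately have "real h * (z \<bullet> \<theta>) < real h" using h0 by simp
    moreover obtain k where k: "real h * (z \<bullet> \<theta>) = of_int k"
      using z_inner(2)[OF \<theta>] by (auto elim: Ints_cases)
    ultimately have "of_int k < (of_int (int h) :: real)" by simp
    then have "k + 1 \<le> int h" by simp
    then have "real_of_int (k + 1) \<le> of_int (int h)" by (simp only: of_int_le_iff)
    then show ?thesis by (simp add: k)
  qed
  \<comment> \<open>Each h (\<delta> \<bullet> z) is at least 1, yet their sum weighted by the
    coefficients of \<open>\<theta>\<close> is at most h - 1, the sum of the weights. The weights
    are positive, so every value is 1.\<close>
  moreover have "real h * (z \<bullet> \<theta>) = (\<Sum>\<delta>\<in>\<Delta>. cf \<theta> \<delta> * (real h * (\<delta> \<bullet> z)))"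
    by (simp add: inner_commute[of z] inner_cf[of \<theta>] sum_distrib_left mult_ac)
  moreover have "real h - 1 = (\<Sum>\<delta>\<in>\<Delta>. cf \<theta> \<delta>)" by (simp add: coxeter_eq height_def)
  ultimately have le: "(\<Sum>\<delta>\<in>\<Delta>. cf \<theta> \<delta> * (real h * (\<delta> \<bullet> z) - 1)) \<le> 0"
    by (simp add: right_diff_distrib sum_subtractf)
  have nonneg: "0 \<le> cf \<theta> \<delta> * (real h * (\<delta> \<bullet> z) - 1)" if "\<delta> \<in> \<Delta>" for \<delta>
    using simple[OF that] cf_nonneg[OF highest_positive that] by simp
  have "(\<Sum>\<delta>\<in>\<Delta>. cf \<theta> \<delta> * (real h * (\<delta> \<bullet> z) - 1)) = 0"
    using le by (rule antisym) (intro sum_nonneg nonneg)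
  then have "\<forall>\<delta>\<in>\<Delta>. cf \<theta> \<delta> * (real h * (\<delta> \<bullet> z) - 1) = 0"
    by (subst (asm) sum_nonneg_eq_0_iff) (use nonneg finite_base in auto)
  then have "real h * (\<delta> \<bullet> z) = 1" if "\<delta> \<in> \<Delta>" for \<delta>
    using that dominant_full_support[OF highest_dominant that] by fastforce
  then have "z = c"
    using h0 by (intro eq_of_inner_simple) (simp add: c_def inner_simple_rho field_simps)
  then show ?thesis using w(2) q by (auto simp: z_def x_def c_def)
qed

text \<open>The gap between the two sides is the sum of (y \<bullet> \<beta>)(b - y \<bullet>
  \<beta>), with nonnegative terms; equality puts every y \<bullet> \<beta> at 0 or b.\<close>

lemma dilated_alcove_bound:
  assumes "y \<in> Q" and simple: "\<And>\<delta>. \<delta> \<in> \<Delta> \<Longrightarrow> 0 \<le> y \<bullet> \<delta>" and highest: "y \<bullet> \<theta> \<le> real b"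
    and "b > 0" "coprime h b"
  shows "real h * (y \<bullet> y) \<le> 2 * real b * (y \<bullet> \<rho>)"
    and "real h * (y \<bullet> y) = 2 * real b * (y \<bullet> \<rho>) \<Longrightarrow> y = 0"
proof -
  have range: "0 \<le> y \<bullet> \<beta>" "y \<bullet> \<beta> \<le> real b" if \<beta>: "\<beta> \<in> P" for \<beta>
  proof -
    show "0 \<le> y \<bullet> \<beta>"
      by (subst inner_commute, subst inner_cf)
        (use simple cf_nonneg[OF \<beta>] in \<open>auto intro!: sum_nonneg simp: inner_commute[of _ y]\<close>)
    have "0 \<le> (\<theta> - \<beta>) \<bullet> y"
      by (subst inner_cf) (use simple cf_le_highest[OF positive_root[OF \<beta>]] in
          \<open>auto intro!: sum_nonneg mult_nonneg_nonneg simp: cf_diff inner_commute[of _ y]\<close>)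
    then show "y \<bullet> \<beta> \<le> real b" using highest
      by (simp add: inner_diff_left inner_commute[of \<theta> y] inner_commute[of \<beta> y])
  qed
  have "(\<Sum>\<beta>\<in>P. y \<bullet> \<beta>) = 2 * (y \<bullet> \<rho>)" by (simp flip: inner_sum_right two_rho)
  then have diff: "(\<Sum>\<beta>\<in>P. (y \<bullet> \<beta>) * (real b - y \<bullet> \<beta>)) = 2 * real b * (y \<bullet> \<rho>) - real h * (y \<bullet> y)"
    by (simp add: right_diff_distrib sum_subtractf sum_inner_sq flip: power2_eq_square sum_distrib_right)
  have nonneg: "0 \<le> (y \<bullet> \<beta>) * (real b - y \<bullet> \<beta>)" if "\<beta> \<in> P" for \<beta> using range[OF that] by simp
  show "real h * (y \<bullet> y) \<le> 2 * real b * (y \<bullet> \<rho>)"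
    using sum_nonneg[of P "\<lambda>\<beta>. (y \<bullet> \<beta>) * (real b - y \<bullet> \<beta>)"] nonneg diff by simp
  assume "real h * (y \<bullet> y) = 2 * real b * (y \<bullet> \<rho>)"
  then have "(\<Sum>\<beta>\<in>P. (y \<bullet> \<beta>) * (real b - y \<bullet> \<beta>)) = 0" using diff by simp
  then have "\<forall>\<beta>\<in>P. (y \<bullet> \<beta>) * (real b - y \<bullet> \<beta>) = 0"
    by (subst (asm) sum_nonneg_eq_0_iff) (use nonneg finite_positive in auto)
  then have ends: "y \<bullet> \<beta> = 0 \<or> y \<bullet> \<beta> = real b" if "\<beta> \<in> P" for \<beta> using that by auto
  define \<omega> where "\<omega> = (1 / real b) *\<^sub>R y"
  have \<omega>_inner: "\<omega> \<bullet> \<beta> = 0 \<or> \<omega> \<bullet> \<beta> = 1" if "\<beta> \<in> P" for \<beta>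
    using ends[OF that] \<open>b > 0\<close> by (auto simp: \<omega>_def)
  \<comment> \<open>This sum equals h \<omega> and has integer coefficients; that is why h y/b is a
    lattice vector.\<close>
  have "(\<Sum>\<beta>\<in>P. (\<omega> \<bullet> \<beta>) *\<^sub>R \<beta>) \<in> Q"
  proof (intro lattice_sum lattice_scale)
    show "\<omega> \<bullet> \<beta> \<in> \<int>" if "\<beta> \<in> P" for \<beta> using \<omega>_inner[OF that] by auto
  qed (simp add: lattice_root positive_root)
  then have h\<omega>: "real h *\<^sub>R \<omega> \<in> Q" by (simp only: sum_inner_positive)
  have b\<omega>: "real b *\<^sub>R \<omega> = y" using \<open>b > 0\<close> by (simp add: \<omega>_def)
  obtain u v where uv: "u * int h + v * int b = 1"
    using bezout_int[of "int h" "int b"] assms(5) by (auto simp: coprime_iff_gcd_eq_1)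
  have "\<omega> = of_int (u * int h + v * int b) *\<^sub>R \<omega>" by (simp only: uv) simp
  also have "\<dots> = of_int u *\<^sub>R (real h *\<^sub>R \<omega>) + of_int v *\<^sub>R y"
    by (simp add: scaleR_add_left flip: b\<omega>)
  also have "\<dots> \<in> Q"
    by (intro lattice_add lattice_scale[OF h\<omega>] lattice_scale[OF assms(1)] Ints_of_int)
  finally have "\<omega> \<in> Q" .
  moreover have "\<omega> \<bullet> \<alpha> \<le> 1" if "\<alpha> \<in> \<Phi>" for \<alpha>
    using root_sign[OF that] \<omega>_inner[of \<alpha>] \<omega>_inner[of "- \<alpha>"] by auto
  ultimately have "\<omega> = 0" by (rule minuscule_lattice_zero)
  then show "y = 0" using b\<omega> by simp
qed

text \<open>Completing the square makes size a function of the distance to c = \<rho>/h, and the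
  isometry turns that into the distance from y to b c. The constant h |c|^2 / 2 comes from the
  strange formula.\<close>

lemma size_affine:
  assumes "root_automorphism w" and center: "w ((real b / real h) *\<^sub>R \<rho>) + q = (1 / real h) *\<^sub>R \<rho>"
  shows "size_stat \<Phi> \<Delta> (w y + q) =
    real DIM('a) * ((real b)\<^sup>2 - 1) * (real h + 1) / 24
      - (2 * real b * (y \<bullet> \<rho>) - real h * (y \<bullet> y)) / 2"
proof -
  define c where "c = (1 / real h) *\<^sub>R \<rho>"
  have h0: "real h > 0" using coxeter_ge_2 by simp
  have \<rho>: "\<rho> = real h *\<^sub>R c" using h0 by (simp add: c_def)
  have w: "linear w" "\<And>x. w x \<bullet> w x = x \<bullet> x" using assms(1) by (auto simp: root_automorphism_def)
  have "size_stat \<Phi> \<Delta> x = real h / 2 * ((x - c) \<bullet> (x - c) - c \<bullet> c)" for x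
    unfolding size_stat_def dual_coxeter_eq power2_norm_eq_inner \<rho>
    by (simp add: inner_diff_left inner_diff_right inner_commute[of c x] algebra_simps)
  then have "size_stat \<Phi> \<Delta> (w y + q) = real h / 2 * ((w y + q - c) \<bullet> (w y + q - c) - c \<bullet> c)" .
  also have "w y + q - c = w (y - real b *\<^sub>R c)"
  proof -
    have "q = c - w (real b *\<^sub>R c)" using center by (simp add: c_def eq_diff_eq add.commute)
    then show ?thesis by (simp add: linear_diff[OF w(1)])
  qed
  also have "w (y - real b *\<^sub>R c) \<bullet> w (y - real b *\<^sub>R c) = (y - real b *\<^sub>R c) \<bullet> (y - real b *\<^sub>R c)"
    by (rule w(2))
  also have "real h / 2 * (\<dots> - c \<bullet> c) =
      ((real b)\<^sup>2 - 1) * (real h * (c \<bullet> c) / 2) - (2 * real b * (y \<bullet> \<rho>) - real h * (y \<bullet> y)) / 2"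
    unfolding \<rho>
    by (simp add: inner_diff_left inner_diff_right inner_commute[of c y] power2_eq_square field_simps)
  also have "real h * (c \<bullet> c) / 2 = real DIM('a) * (real h + 1) / 24"
  proof -
    have "12 * real h * (real h * (c \<bullet> c)) = real h * (real DIM('a) * (real h + 1))"
      using strange_formula \<rho> by (simp add: mult_ac)
    then show ?thesis using h0 by (simp add: mult_ac)
  qed
  finally show ?thesis by (simp add: mult_ac)
qed

text \<open>Pair the equation for the centers with w \<beta> and multiply by h. For q in the
  lattice, w thus multiplies heights by b modulo h.\<close>

lemma ht_automorphism:
  assumes "root_automorphism w" and center: "w ((real b / real h) *\<^sub>R \<rho>) + q = (1 / real h) *\<^sub>R \<rho>"
  shows "ht (w \<beta>) = real b * ht \<beta> + real h * (q \<bullet> w \<beta>)"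
proof -
  have h0: "real h > 0" using coxeter_ge_2 by simp
  have "ht (w \<beta>) / real h = ((1 / real h) *\<^sub>R \<rho>) \<bullet> w \<beta>" by (simp add: ht_eq inner_commute)
  also have "\<dots> = w ((real b / real h) *\<^sub>R \<rho>) \<bullet> w \<beta> + q \<bullet> w \<beta>" by (simp add: inner_add_left flip: center)
  also have "w ((real b / real h) *\<^sub>R \<rho>) \<bullet> w \<beta> = real b * ht \<beta> / real h"
    using assms(1) by (simp add: root_automorphism_def ht_eq inner_commute)
  finally show ?thesis using h0 by (simp add: field_simps)
qed

text \<open>Root heights lie strictly between -h and h, a range that meets the class of r only in r
  and r - h.\<close>

lemma ht_residue:
  assumes "\<alpha> \<in> \<Phi>" "ht \<alpha> = real r + real h * m" "m \<in> \<int>" "0 < r" "r < h"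
  shows "m = 0 \<or> m = -1"
proof -
  obtain k where k: "m = of_int k" using assms by (auto elim: Ints_cases)
  have "real_of_int (int r + int h * k) = ht \<alpha>" using assms k by simp
  then have *: "int r + int h * k < int h" "- int h < int r + int h * k"
    using abs_ht(2)[OF assms(1)] by linarith+
  have "k < 1"
  proof (rule ccontr)
    assume "\<not> k < 1"
    then have "int h * 1 \<le> int h * k" by (intro mult_left_mono) auto
    then show False using * assms(4) by linarith
  qed
  moreover have "-2 < k"
  proof (rule ccontr)
    assume "\<not> -2 < k"
    then have "int h * k \<le> int h * (-2)" by (intro mult_left_mono) auto
    then show False using * assms(5) by linarith
  qed
  ultimately show ?thesis using k by force
qed

section \<open>The Sommers region in alcove coordinates\<close>

lemma sommers_regionD:
  assumes "x \<in> sommers_region \<Phi> \<Delta> b" "\<alpha> \<in> \<Phi>"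
  shows "ht \<alpha> = real (b mod h) \<Longrightarrow> - real (b div h) \<le> x \<bullet> \<alpha>"
    and "ht \<alpha> = real (h - b mod h) \<Longrightarrow> x \<bullet> \<alpha> \<le> real (b div h) + 1"
  using assms by (auto simp: sommers_region_def roots_of_height_def Let_def)

context
  fixes w q and b :: nat
  assumes coprime: "coprime h b" and w: "root_automorphism w" and q: "q \<in> Q"
    and center: "w ((real b / real h) *\<^sub>R \<rho>) + q = (1 / real h) *\<^sub>R \<rho>"
begin

private lemma div_mod: "0 < b mod h" "b mod h < h"
    "real b = real h * real (b div h) + real (b mod h)"
proof -
  have "\<not> h dvd b" using coprime coxeter_ge_2 coprime_absorb_left[of h b] by auto
  then show "0 < b mod h" by (simp add: mod_greater_zero_iff_not_dvd)
  show "b mod h < h" using coxeter_ge_2 by simp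
  show "real b = real h * real (b div h) + real (b mod h)"
    by (metis mult_div_mod_eq of_nat_add of_nat_mult)
qed

private lemma inner_w: "w x \<bullet> w y = x \<bullet> y"
  using w by (simp add: root_automorphism_def)

text \<open>Each wall inequality of the dilated alcove is, after the affine map, one of the
  inequalities of the region: w \<delta> and -w \<open>\<theta>\<close> have height r or r - h, and
  in the second case the opposite root has height h - r.\<close>

lemma sommers_region_alcove:
  assumes S: "w y + q \<in> sommers_region \<Phi> \<Delta> b"
  shows "\<delta> \<in> \<Delta> \<Longrightarrow> 0 \<le> y \<bullet> \<delta>" and "y \<bullet> \<theta> \<le> real b"
proof -
  let ?r = "b mod h" and ?t = "b div h"
  have dot: "(w y + q) \<bullet> w \<beta> = y \<bullet> \<beta> + q \<bullet> w \<beta>" for \<beta> by (simp add: inner_add_left inner_w)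
  have w\<Phi>: "w \<beta> \<in> \<Phi>" "- w \<beta> \<in> \<Phi>" if "\<beta> \<in> \<Phi>" for \<beta>
    using automorphism_root[OF w that] root_uminus by auto
  have lower: "- real ?t \<le> y \<bullet> \<beta> + q \<bullet> w \<beta>" if "\<beta> \<in> \<Phi>" "ht (w \<beta>) = real ?r" for \<beta>
    using sommers_regionD(1)[OF S w\<Phi>(1)[OF that(1)]] that(2) by (simp add: dot)
  have upper: "y \<bullet> \<beta> + q \<bullet> w \<beta> \<le> real ?t + 1" if "\<beta> \<in> \<Phi>" "ht (w \<beta>) = real h - real ?r" for \<beta>
    using sommers_regionD(2)[OF S w\<Phi>(1)[OF that(1)]] that(2) div_mod(2) by (simp add: dot of_nat_diff)
  have lower': "- (real ?t + 1) \<le> y \<bullet> \<beta> + q \<bullet> w \<beta>" if "\<beta> \<in> \<Phi>" "ht (w \<beta>) = real ?r - real h" for \<beta>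
    using sommers_regionD(2)[OF S w\<Phi>(2)[OF that(1)]] that(2) div_mod(2)
    by (simp add: dot of_nat_diff ht_uminus)
  have upper': "y \<bullet> \<beta> + q \<bullet> w \<beta> \<le> real ?t" if "\<beta> \<in> \<Phi>" "ht (w \<beta>) = - real ?r" for \<beta>
    using sommers_regionD(1)[OF S w\<Phi>(2)[OF that(1)]] that(2) by (simp add: dot ht_uminus)
  show "0 \<le> y \<bullet> \<delta>" if \<delta>: "\<delta> \<in> \<Delta>"
  proof -
    have "ht \<delta> = 1" "\<delta> \<in> \<Phi>" using \<delta> by (auto simp: ht_eq inner_simple_rho simple_root)
    \<comment> \<open>The quotient of \<open>ht (w \<delta>)\<close> by h. The lower bound -t + m on
      the product with w \<delta> becomes y \<bullet> \<delta> \<ge> 0 for both values of m.\<close>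
    define m where "m = real ?t + q \<bullet> w \<delta>"
    have "m \<in> \<int>" using inner_lattice_root[OF q w\<Phi>(1)[OF \<open>\<delta> \<in> \<Phi>\<close>]] by (simp add: m_def)
    have ht: "ht (w \<delta>) = real ?r + real h * m"
      using ht_automorphism[OF w center, of \<delta>] \<open>ht \<delta> = 1\<close> div_mod(3) by (simp add: m_def algebra_simps)
    then have "m = 0 \<or> m = -1"
      using ht_residue[OF w\<Phi>(1)[OF \<open>\<delta> \<in> \<Phi>\<close>] _ \<open>m \<in> \<int>\<close>] div_mod by blast
    then show ?thesis
    proof
      assume "m = 0"
      then show ?thesis using lower[OF \<open>\<delta> \<in> \<Phi>\<close>] ht by (simp add: m_def)
    next
      assume "m = -1"
      then show ?thesis using lower'[OF \<open>\<delta> \<in> \<Phi>\<close>] ht by (simp add: m_def)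
    qed
  qed
  show "y \<bullet> \<theta> \<le> real b"
  proof -
    have ht_\<theta>: "ht \<theta> = real h - 1" and \<theta>: "\<theta> \<in> \<Phi>"
      using coxeter_eq positive_root[OF highest_positive] by auto
    \<comment> \<open>From \<open>ht (- w \<theta>)\<close> = -b(h - 1) - h (q \<bullet> w
      \<open>\<theta>\<close>) and b = th + r.\<close>
    define m where "m = real ?t - real b - q \<bullet> w \<theta>"
    have "m \<in> \<int>" using inner_lattice_root[OF q w\<Phi>(1)[OF \<theta>]] by (simp add: m_def)
    have ht: "ht (- w \<theta>) = real ?r + real h * m"
      using ht_automorphism[OF w center, of \<theta>] ht_\<theta> div_mod(3)
      by (simp add: m_def ht_uminus algebra_simps)
    then have "m = 0 \<or> m = -1"
      using ht_residue[OF w\<Phi>(2)[OF \<theta>] _ \<open>m \<in> \<int>\<close>] div_mod by blast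
    then show ?thesis
    proof
      assume "m = 0"
      then show ?thesis using upper'[OF \<theta>] ht by (simp add: m_def ht_uminus)
    next
      assume "m = -1"
      then show ?thesis using upper[OF \<theta>] ht by (simp add: m_def ht_uminus)
    qed
  qed
qed

text \<open>Inverts the congruence: if w \<beta> has height r modulo h then b ht \<beta> is
  congruent to b, so ht \<beta> is 1 or 1 - h. In both cases b (ht \<beta> - 1) \<le> 0, which
  rearranges to the required bound on q.\<close>

lemma translation_in_sommers_region:
  shows "q \<in> sommers_region \<Phi> \<Delta> b"
proof -
  let ?r = "b mod h" and ?t = "b div h"
  have lower: "m - real ?t \<le> q \<bullet> \<alpha>"
    if \<alpha>: "\<alpha> \<in> \<Phi>" and ht: "ht \<alpha> = real ?r + real h * m" and m: "m \<in> \<int>" for \<alpha> m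
  proof -
    obtain \<beta> where \<beta>: "\<beta> \<in> \<Phi>" "w \<beta> = \<alpha>" using automorphism_root_preimage[OF w \<alpha>] .
    obtain i where i: "ht \<beta> = of_int i" using ht_Ints[OF \<beta>(1)] by (auto elim: Ints_cases)
    have "m - real ?t - q \<bullet> \<alpha> \<in> \<int>"
      using m inner_lattice_root[OF q \<alpha>] by (intro Ints_diff) auto
    then obtain k where k: "m - real ?t - q \<bullet> \<alpha> = of_int k" by (auto elim: Ints_cases)
    have "real b * (ht \<beta> - 1) = real h * (m - real ?t - q \<bullet> \<alpha>)"
    proof -
      have "real b * ht \<beta> = real ?r + real h * m - real h * (q \<bullet> \<alpha>)"
        using ht_automorphism[OF w center, of \<beta>] ht by (simp add: \<beta>(2))
      moreover have "real b * (ht \<beta> - 1) = real b * ht \<beta> - real b"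
        by (simp add: right_diff_distrib)
      moreover have "real h * (m - real ?t - q \<bullet> \<alpha>) = real h * m - real h * real ?t - real h * (q \<bullet> \<alpha>)"
        by (simp add: right_diff_distrib)
      ultimately show ?thesis using div_mod(3) by linarith
    qed
    then have eq: "real b * (of_int i - 1) = real h * of_int k" by (simp add: i k)
    then have "real_of_int (int b * (i - 1)) = of_int (int h * k)" by simp
    then have "int b * (i - 1) = int h * k" by linarith
    then have "int h dvd int b * (i - 1)" by simp
    then have "int h dvd i - 1" using coprime by (simp add: coprime_dvd_mult_right_iff)
    then obtain j where j: "i - 1 = int h * j" by auto
    then have "i = 1 + int h * j" by simp
    then have "of_int i = 1 + real h * of_int j" by simp
    \<comment> \<open>\<open>ht_residue\<close> with residue 1, which is admissible because h is at
      least 2.\<close>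
    then have "of_int j = (0 :: real) \<or> of_int j = (-1 :: real)"
      using coxeter_ge_2 i by (intro ht_residue[OF \<beta>(1), of 1]) simp_all
    then have "j = 0 \<or> j = -1" by linarith
    then have "i - 1 \<le> 0" using j by auto
    then have "real h * of_int k \<le> 0"
      unfolding eq[symmetric] by (intro mult_nonneg_nonpos) simp_all
    then show ?thesis using k coxeter_ge_2 by (simp add: mult_le_0_iff)
  qed
  have "- real ?t \<le> q \<bullet> \<alpha>" if "\<alpha> \<in> \<Phi>" "ht \<alpha> = real ?r" for \<alpha>
    using lower[of \<alpha> 0] that by simp
  \<comment> \<open>A root of height h - r has a negative of height r - h, the case m = -1 of
    \<open>lower\<close>.\<close>
  moreover have "q \<bullet> \<alpha> \<le> real ?t + 1" if "\<alpha> \<in> \<Phi>" "ht \<alpha> = real (h - ?r)" for \<alpha>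
    using lower[of "- \<alpha>" "- 1"] root_uminus[of \<alpha>] that div_mod(2) by (simp add: ht_uminus of_nat_diff)
  ultimately show ?thesis
    unfolding sommers_region_def roots_of_height_def Let_def by blast
qed

end

end

theorem theorem1p9:
  fixes \<Phi> \<Delta> :: "'a::euclidean_space set" and n h b :: nat
  assumes "crystallographic_root_system \<Phi>"
    and "irreducible_root_system \<Phi>"
    and "simply_laced \<Phi>"
    and "simple_roots \<Phi> \<Delta>"
    and "n = dim \<Phi>"
    and "h = coxeter_number \<Phi> \<Delta>"
    and "b > 0"
    and "gcd h b = 1"
  shows "(\<forall>x \<in> sommers_region \<Phi> \<Delta> b \<inter> coroot_lattice \<Phi>.
            size_stat \<Phi> \<Delta> x \<le> real n * ((real b)\<^sup>2 - 1) * (real h + 1) / 24)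
       \<and> (\<exists>!x. x \<in> sommers_region \<Phi> \<Delta> b \<inter> coroot_lattice \<Phi> \<and>
            size_stat \<Phi> \<Delta> x = real n * ((real b)\<^sup>2 - 1) * (real h + 1) / 24)"
proof -
  interpret simply_laced_root_system \<Phi> \<Delta>
    using assms(1-4) by unfold_locales
  let ?m = "real n * ((real b)\<^sup>2 - 1) * (real h + 1) / 24"
  have n: "n = DIM('a)"
    using span_roots assms(5) dim_span[of \<Phi>] by simp
  have cop: "coprime (coxeter_number \<Phi> \<Delta>) b"
    using assms(6,8) by (simp add: coprime_iff_gcd_eq_1)
  obtain w q where w: "root_automorphism w" and q: "q \<in> coroot_lattice \<Phi>"
    and center: "w ((real b / real (coxeter_number \<Phi> \<Delta>)) *\<^sub>R weyl_vector \<Phi> \<Delta>) + q =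
      (1 / real (coxeter_number \<Phi> \<Delta>)) *\<^sub>R weyl_vector \<Phi> \<Delta>"
    using exists_affine_map[OF cop] by blast
  have w0: "w 0 = 0" using w by (simp add: root_automorphism_def linear_0)
  have size: "size_stat \<Phi> \<Delta> (w y + q) = ?m - (2 * real b * (y \<bullet> weyl_vector \<Phi> \<Delta>) - real h * (y \<bullet> y)) / 2"
    for y
    using size_affine[OF w center, of y] by (simp add: n assms(6))
  have bound: "size_stat \<Phi> \<Delta> x \<le> ?m" "size_stat \<Phi> \<Delta> x = ?m \<Longrightarrow> x = q"
    if "x \<in> sommers_region \<Phi> \<Delta> b \<inter> coroot_lattice \<Phi>" for x
  proof -
    have "x - q \<in> w ` coroot_lattice \<Phi>"
      using that q automorphism_lattice[OF w] lattice_diff by simp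
    then obtain y where "y \<in> coroot_lattice \<Phi>" "x - q = w y" by blast
    then have y: "y \<in> coroot_lattice \<Phi>" "x = w y + q" by (simp_all add: diff_eq_eq)
    note S = sommers_region_alcove[OF cop w q center, of y]
    have *: "real h * (y \<bullet> y) \<le> 2 * real b * (y \<bullet> weyl_vector \<Phi> \<Delta>)"
      "real h * (y \<bullet> y) = 2 * real b * (y \<bullet> weyl_vector \<Phi> \<Delta>) \<Longrightarrow> y = 0"
      using dilated_alcove_bound[OF y(1) S assms(7) cop] that y(2) assms(6) by auto
    show "size_stat \<Phi> \<Delta> x \<le> ?m" using *(1) by (simp add: size y(2))
    assume "size_stat \<Phi> \<Delta> x = ?m"
    then show "x = q" using *(2) w0 by (simp add: size y(2))
  qed
  \<comment> \<open>The maximizer is the image of the vertex y = 0 of the dilated alcove.\<close>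
  have "size_stat \<Phi> \<Delta> q = ?m" using size[of 0] by (simp add: w0)
  moreover have "q \<in> sommers_region \<Phi> \<Delta> b"
    by (rule translation_in_sommers_region[OF cop w q center])
  ultimately show ?thesis using bound q by blast
qed

end
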